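(* For a metric space $\mathcal P$ and a quasi-Banach function lattice $X$ (as in the context) consider the properties (A)–(G) defined in the context. Then, for all such $\mathcal P$ and $X$: (i) $\big((D)\text{ and }(G)\big)\iff\big((E)\text{ and }(F)\big)\iff(A)$; (ii) $(A)\Rightarrow(B)\Rightarrow(C)\Rightarrow(D)\Rightarrow(E)$, $(A)\Rightarrow(F)$ and $(F)\Rightarrow(G)$. Moreover, none of the following implications holds in general; for each of them there exist a metric space $\mathcal P$ satisfying the standing assumptions and a (normed) Banach function lattice $X$ for which it fails: $(B)\Rightarrow(A)$, $(C)\Rightarrow(B)$, $(D)\Rightarrow(C)$, $(B)\Rightarrow(G)$, $(G)\Rightarrow(F)$, $(F)\Rightarrow(E)$. Finally, there exist $\mathcal P$ and $X$ for which all of (A)–(G) fail.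
   Context: Standing assumptions: $\mathcal P=(\mathcal P,d,\mu)$ is a metric space with a positive complete Borel measure $\mu$ such that $0<\mu(B)<\infty$ for every ball $B$; $\mu$ is extended as an outer measure to all subsets. $\overline{\mathbf R}=[-\infty,\infty]$. A quasi-Banach function lattice $X=X(\mathcal P)$ is a vector space of extended real-valued measurable functions defined everywhere on $\mathcal P$ with a functional $\|\cdot\|_X$ such that: $X=\{u:\|u\|_X<\infty\}$; $\|u\|_X=0$ iff $u=0$ a.e., $\|au\|_X=|a|\|u\|_X$, and $\|u+v\|_X\le c_\wedge(\|u\|_X+\|v\|_X)$ for some constant $c_\wedge\ge1$; $|u|\le|v|$ a.e. implies $\|u\|_X\le\|v\|_X$; and if $u_n\ge0$ a.e. then $\|\sum_{n\ge1}u_n\|_X\le\sum_{n\ge1}c_\wedge^n\|u_n\|_X$. The quasinorm is assumed continuous: $\|u_n-u\|_X\to0$ implies $\|u_n\|_X\to\|u\|_X$. If $c_\wedge=1$, $X$ is called a Banach function lattice. Curves are continuous maps from compact intervals; rectifiable curves are parametrized by arc length. A Borel $g:\mathcal P\to[0,\infty]$ is an upper gradient of $u:\mathcal P\to\overline{\mathbf R}$ if $|u(\gamma(0))-u(\gamma(l_\gamma))|\le\int_\gamma g\,ds$ for every nonconstant rectifiable curve $\gamma:[0,l_\gamma]\to\mathcal P$ (with $|(\pm\infty)-(\pm\infty)|=\infty$). $N^1X(\mathcal P)=\{u\in X:\|u\|_{N^1X}:=\|u\|_X+\inf_g\|g\|_X<\infty\}$, infimum over upper gradients of $u$. Capacity: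 $C_X(E)=\inf\{\|u\|_{N^1X}:u\in N^1X,\ u\ge1\text{ on }E\}$; "q.e." means outside a set of zero capacity. $C_X$ is a $c$-quasiouter capacity ($c\ge1$) if $\inf\{C_X(G):G\supset E\text{ open}\}\le cC_X(E)$ for all $E\subset\mathcal P$; quasiouter if this holds for some $c$; outer if it holds with $c=1$; outer for sets of zero capacity if whenever $C_X(E)=0$ and $\varepsilon>0$ there is an open $G\supset E$ with $C_X(G)<\varepsilon$. A function $u:\mathcal P\to\overline{\mathbf R}$ is weakly quasicontinuous if for every $\varepsilon>0$ there is $E$ with $C_X(E)<\varepsilon$ and $u|_{\mathcal P\setminus E}$ (real-valued) continuous; quasicontinuous if $E$ can in addition be chosen open. Properties: (A) every $u\in N^1X(\mathcal P)$ is quasicontinuous; (B) $C_X$ is an outer capacity; (C) $C_X$ is a quasiouter capacity; (D) every weakly quasicontinuous $u:\mathcal P\to\overline{\mathbf R}$ is quasicontinuous; (E) $C_X$ is an outer capacity for sets of zero capacity; (F) every $u\in N^1X(\mathcal P)$ has a quasicontinuous $v$ with $v=u$ q.e.; (G) every $u\in N^1X(\mathcal P)$ is weakly quasicontinuous. *)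

theory Defs
  imports "HOL-Analysis.Analysis"
begin

definition mborel :: "'a metric \<Rightarrow> 'a measure" where
  "mborel m = sigma (mspace m) {U. openin (mtopology_of m) U}"

text \<open>Standing assumptions: m is the metric space, M a complete Borel measure on it with
  balls of positive finite measure, nX the quasinorm (values in [0,\<infinity>]) of the lattice X with
  constant c (= c_wedge \<ge> 1). Functions in X are extended-real valued and measurable.\<close>
definition inX :: "'a measure \<Rightarrow> (('a \<Rightarrow> ereal) \<Rightarrow> ennreal) \<Rightarrow> ('a \<Rightarrow> ereal) \<Rightarrow> bool" where
  "inX M nX u \<longleftrightarrow> u \<in> borel_measurable M \<and> nX u < \<infinity>"

definition QBFL :: "'a metric \<Rightarrow> 'a measure \<Rightarrow> (('a \<Rightarrow> ereal) \<Rightarrow> ennreal) \<Rightarrow> real \<Rightarrow> bool" where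
  "QBFL m M nX c \<longleftrightarrow>
     space M = mspace m \<and>
     sets (mborel m) \<subseteq> sets M \<and>
     complete_measure M \<and>
     (\<forall>x\<in>mspace m. \<forall>r>0. 0 < emeasure M (mball_of m x r) \<and> emeasure M (mball_of m x r) < \<infinity>) \<and>
     1 \<le> c \<and>
     (\<forall>u\<in>borel_measurable M. nX u = 0 \<longleftrightarrow> (AE x in M. u x = 0)) \<and>
     (\<forall>u\<in>borel_measurable M. \<forall>a::real. nX (\<lambda>x. ereal a * u x) = ennreal \<bar>a\<bar> * nX u) \<and>
     (\<forall>u\<in>borel_measurable M. \<forall>v\<in>borel_measurable M.
        nX (\<lambda>x. u x + v x) \<le> ennreal c * (nX u + nX v)) \<and>
     (\<forall>u\<in>borel_measurable M. \<forall>v\<in>borel_measurable M.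
        (AE x in M. \<bar>u x\<bar> \<le> \<bar>v x\<bar>) \<longrightarrow> nX u \<le> nX v) \<and>
     (\<forall>us. (\<forall>n. us n \<in> borel_measurable M) \<longrightarrow> (AE x in M. \<forall>n. 0 \<le> us n x) \<longrightarrow>
        nX (\<lambda>x. \<Sum>n. us n x) \<le> (\<Sum>n. ennreal (c ^ Suc n) * nX (us n))) \<and>
     (\<forall>us u. (\<forall>n. inX M nX (us n)) \<longrightarrow> inX M nX u \<longrightarrow>
        ((\<lambda>n. nX (\<lambda>x. us n x - u x)) \<longlonglongrightarrow> 0) \<longrightarrow> ((\<lambda>n. nX (us n)) \<longlonglongrightarrow> nX u))"

definition curve_length :: "'a metric \<Rightarrow> (real \<Rightarrow> 'a) \<Rightarrow> real \<Rightarrow> real \<Rightarrow> ennreal" where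
  "curve_length m \<gamma> a b =
     (SUP p \<in> {(n::nat, \<tau>::nat \<Rightarrow> real). \<tau> 0 = a \<and> \<tau> n = b \<and> (\<forall>i<n. \<tau> i \<le> \<tau> (Suc i))}.
        ennreal (\<Sum>i<fst p. mdist m (\<gamma> (snd p i)) (\<gamma> (snd p (Suc i)))))"

definition arc_curve :: "'a metric \<Rightarrow> (real \<Rightarrow> 'a) \<Rightarrow> real \<Rightarrow> bool" where
  "arc_curve m \<gamma> l \<longleftrightarrow> 0 < l \<and> (\<forall>t\<in>{0..l}. \<gamma> t \<in> mspace m) \<and>
     continuous_map (top_of_set {0..l}) (mtopology_of m) \<gamma> \<and>
     (\<forall>s t. 0 \<le> s \<longrightarrow> s \<le> t \<longrightarrow> t \<le> l \<longrightarrow> curve_length m \<gamma> s t = ennreal (t - s))"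

text \<open>Upper gradient; in ereal, |(\<plusminus>\<infinity>) - (\<plusminus>\<infinity>)| = \<infinity> holds automatically.\<close>
definition upper_gradient :: "'a metric \<Rightarrow> ('a \<Rightarrow> ereal) \<Rightarrow> ('a \<Rightarrow> ennreal) \<Rightarrow> bool" where
  "upper_gradient m u g \<longleftrightarrow> g \<in> borel_measurable (mborel m) \<and>
     (\<forall>\<gamma> l. arc_curve m \<gamma> l \<longrightarrow>
        \<bar>u (\<gamma> 0) - u (\<gamma> l)\<bar> \<le> enn2ereal (\<integral>\<^sup>+ t. g (\<gamma> t) * indicator {0..l} t \<partial>lborel))"

definition N1norm :: "'a metric \<Rightarrow> (('a \<Rightarrow> ereal) \<Rightarrow> ennreal) \<Rightarrow> ('a \<Rightarrow> ereal) \<Rightarrow> ennreal" where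
  "N1norm m nX u = nX u + (INF g \<in> {g. upper_gradient m u g}. nX (\<lambda>x. enn2ereal (g x)))"

definition inN1 :: "'a metric \<Rightarrow> 'a measure \<Rightarrow> (('a \<Rightarrow> ereal) \<Rightarrow> ennreal) \<Rightarrow> ('a \<Rightarrow> ereal) \<Rightarrow> bool" where
  "inN1 m M nX u \<longleftrightarrow> u \<in> borel_measurable M \<and> N1norm m nX u < \<infinity>"

definition cap :: "'a metric \<Rightarrow> 'a measure \<Rightarrow> (('a \<Rightarrow> ereal) \<Rightarrow> ennreal) \<Rightarrow> 'a set \<Rightarrow> ennreal" where
  "cap m M nX E = (INF u \<in> {u. inN1 m M nX u \<and> (\<forall>x\<in>E. 1 \<le> u x)}. N1norm m nX u)"

definition weakly_quasicont :: "'a metric \<Rightarrow> 'a measure \<Rightarrow> (('a \<Rightarrow> ereal) \<Rightarrow> ennreal) \<Rightarrow> ('a \<Rightarrow> ereal) \<Rightarrow> bool" where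
  "weakly_quasicont m M nX u \<longleftrightarrow> (\<forall>\<epsilon>::real>0. \<exists>E\<subseteq>mspace m. cap m M nX E < ennreal \<epsilon> \<and>
      (\<forall>x\<in>mspace m - E. \<bar>u x\<bar> \<noteq> \<infinity>) \<and>
      continuous_map (subtopology (mtopology_of m) (mspace m - E)) euclideanreal (\<lambda>x. real_of_ereal (u x)))"

definition quasicont :: "'a metric \<Rightarrow> 'a measure \<Rightarrow> (('a \<Rightarrow> ereal) \<Rightarrow> ennreal) \<Rightarrow> ('a \<Rightarrow> ereal) \<Rightarrow> bool" where
  "quasicont m M nX u \<longleftrightarrow> (\<forall>\<epsilon>::real>0. \<exists>E. openin (mtopology_of m) E \<and> cap m M nX E < ennreal \<epsilon> \<and>
      (\<forall>x\<in>mspace m - E. \<bar>u x\<bar> \<noteq> \<infinity>) \<and>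
      continuous_map (subtopology (mtopology_of m) (mspace m - E)) euclideanreal (\<lambda>x. real_of_ereal (u x)))"

definition quasiouter_c :: "'a metric \<Rightarrow> 'a measure \<Rightarrow> (('a \<Rightarrow> ereal) \<Rightarrow> ennreal) \<Rightarrow> real \<Rightarrow> bool" where
  "quasiouter_c m M nX c \<longleftrightarrow> (\<forall>E\<subseteq>mspace m.
      (INF G \<in> {G. openin (mtopology_of m) G \<and> E \<subseteq> G}. cap m M nX G) \<le> ennreal c * cap m M nX E)"

definition propA where "propA m M nX \<longleftrightarrow> (\<forall>u. inN1 m M nX u \<longrightarrow> quasicont m M nX u)"
definition propB where "propB m M nX \<longleftrightarrow> quasiouter_c m M nX 1"
definition propC where "propC m M nX \<longleftrightarrow> (\<exists>c\<ge>1. quasiouter_c m M nX c)"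
definition propD where "propD m M nX \<longleftrightarrow> (\<forall>u. weakly_quasicont m M nX u \<longrightarrow> quasicont m M nX u)"
definition propE where "propE m M nX \<longleftrightarrow> (\<forall>E\<subseteq>mspace m. cap m M nX E = 0 \<longrightarrow>
      (\<forall>\<epsilon>::real>0. \<exists>G. openin (mtopology_of m) G \<and> E \<subseteq> G \<and> cap m M nX G < ennreal \<epsilon>))"
definition propF where "propF m M nX \<longleftrightarrow> (\<forall>u. inN1 m M nX u \<longrightarrow>
      (\<exists>v. quasicont m M nX v \<and> (\<exists>E\<subseteq>mspace m. cap m M nX E = 0 \<and> (\<forall>x\<in>mspace m - E. v x = u x))))"
definition propG where "propG m M nX \<longleftrightarrow> (\<forall>u. inN1 m M nX u \<longrightarrow> weakly_quasicont m M nX u)"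

end

theory Submission
  imports Defs
begin

text \<open>
  The only step among the implications that is not formal is (A) \<open>\<Longrightarrow>\<close> (B): if \<open>u \<ge> 1\<close> on \<open>E\<close> is almost
  optimal and \<open>u\<close> is continuous off an open set \<open>V\<^sub>n\<close> of capacity below \<open>1/n\<close>, with admissible
  function \<open>v\<^sub>n\<close>, then \<open>V\<^sub>n \<union> {(1 + 1/n) u > 1}\<close> is open, contains \<open>E\<close>, and \<open>(1 + 1/n) u + v\<^sub>n\<close> is
  admissible for it; continuity of the quasinorm gives the capacity estimate.  For (D) \<open>\<Longrightarrow>\<close> (E) test
  with the function that is \<open>\<infinity>\<close> on a set of zero capacity and \<open>0\<close> elsewhere.

  All counterexamples live on one countable space, a disjoint union of convergent sequences
  \<open>(k, n) \<rightarrow> (k, 0)\<close>.  It carries no nonconstant rectifiable curves, so \<open>0\<close> is an upper gradient of every function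
  and the capacity of a set is the norm of its indicator.  The lattices have norm
  \<open>sup\<^sub>k\<^sub>,\<^sub>n (\<alpha> |u(k, 0)| + \<beta>\<^sub>k\<^sub>n |u(k, n)|)\<close>; the weights \<open>\<alpha>\<close>, \<open>\<beta>\<close> control separately the capacity of
  limit points and that of their neighbourhoods.
\<close>

section \<open>Capacity in a quasi-Banach function lattice\<close>

locale qbfl =
  fixes m :: "'a metric" and M :: "'a measure" and nX :: "('a \<Rightarrow> ereal) \<Rightarrow> ennreal" and c :: real
  assumes qbfl: "QBFL m M nX c"
begin

lemmas qbfl_unfolded = qbfl[unfolded QBFL_def]

lemmas space_M = qbfl_unfolded[THEN conjunct1]
  and borel_sets = qbfl_unfolded[THEN conjunct2, THEN conjunct1]
  and c_ge_1 = qbfl_unfolded[THEN conjunct2, THEN conjunct2, THEN conjunct2, THEN conjunct2, THEN conjunct1]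

lemma norm_zero_iff: "u \<in> borel_measurable M \<Longrightarrow> nX u = 0 \<longleftrightarrow> (AE x in M. u x = 0)"
  using qbfl_unfolded by (elim conjE) meson

lemma norm_scale: "u \<in> borel_measurable M \<Longrightarrow> nX (\<lambda>x. ereal a * u x) = ennreal \<bar>a\<bar> * nX u"
  using qbfl_unfolded by (elim conjE) meson

lemma norm_add: "u \<in> borel_measurable M \<Longrightarrow> v \<in> borel_measurable M \<Longrightarrow>
    nX (\<lambda>x. u x + v x) \<le> ennreal c * (nX u + nX v)"
  using qbfl_unfolded by (elim conjE) meson

lemma norm_mono: "u \<in> borel_measurable M \<Longrightarrow> v \<in> borel_measurable M \<Longrightarrow>
    AE x in M. \<bar>u x\<bar> \<le> \<bar>v x\<bar> \<Longrightarrow> nX u \<le> nX v"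
  using qbfl_unfolded by (elim conjE) meson

lemma norm_continuous: "(\<And>n. inX M nX (us n)) \<Longrightarrow> inX M nX u \<Longrightarrow>
    (\<lambda>n. nX (\<lambda>x. us n x - u x)) \<longlonglongrightarrow> 0 \<Longrightarrow> (\<lambda>n. nX (us n)) \<longlonglongrightarrow> nX u"
  using qbfl_unfolded by (elim conjE) meson

text \<open>Upper gradients are Borel functions into \<open>ennreal\<close>, while the norm axioms
  speak of \<open>M\<close>-measurable functions into \<open>ereal\<close>; this conversion is used
  whenever the norm of a gradient is estimated.\<close>

lemma measurable_mborel:
  assumes "g \<in> borel_measurable (mborel m)"
  shows "(\<lambda>x. enn2ereal (g x)) \<in> borel_measurable M"
proof -
  have "space (mborel m) = space M"
    by (simp add: mborel_def space_M space_measure_of_conv)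
  then have "g \<in> borel_measurable M"
    using assms borel_sets unfolding measurable_def by auto
  then show ?thesis by measurable
qed

text \<open>The function \<open>h\<close>, infinite exactly where \<open>u\<close> is, satisfies
  \<open>2 * h = h\<close>. Its norm is dominated by that of \<open>u\<close>, hence finite, and
  equals its own double, so it is 0.\<close>

lemma AE_finite:
  assumes "u \<in> borel_measurable M" "nX u < \<infinity>"
  shows "AE x in M. \<bar>u x\<bar> \<noteq> \<infinity>"
proof -
  define h where "h x = (if \<bar>u x\<bar> = \<infinity> then \<infinity> else 0 :: ereal)" for x
  have [measurable]: "u \<in> borel_measurable M" by fact
  have h[measurable]: "h \<in> borel_measurable M"
    unfolding h_def by measurable
  have "nX h \<le> nX u"
    by (rule norm_mono) (auto simp: h_def)
  then have fin: "nX h < \<infinity>" using assms by (auto intro: le_less_trans)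
  have "(\<lambda>x. ereal 2 * h x) = h" by (auto simp: h_def)
  then have "nX h = 2 * nX h" using norm_scale[OF h, of 2] by simp
  then have "nX h = 0" using fin
    by (cases "nX h") (auto simp: ennreal_mult[symmetric] simp flip: ennreal_numeral)
  then have "AE x in M. h x = 0" using norm_zero_iff h by blast
  then show ?thesis by eventually_elim (auto simp: h_def split: if_splits)
qed

section \<open>Upper gradients: absolute values, scaling and sums\<close>

text \<open>The reverse triangle inequality also holds for infinite values. It lets functions
  admissible for the capacity be taken nonnegative.\<close>

lemma upper_gradient_abs:
  assumes "upper_gradient m u g" shows "upper_gradient m (\<lambda>x. \<bar>u x\<bar>) g"
proof -
  have "\<bar>\<bar>a\<bar> - \<bar>b\<bar>\<bar> \<le> \<bar>a - b\<bar>" for a b :: ereal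
    by (cases a; cases b) auto
  then show ?thesis using assms unfolding upper_gradient_def by (meson order_trans)
qed

text \<open>Linearity of the path integral and the triangle inequality. The scaling by
  \<open>a\<close> serves the functions \<open>(1 + 1/n) * u + v\<close> in the proof that (A)
  implies (B).\<close>

lemma upper_gradient_scale_add:
  assumes u: "upper_gradient m u g" and v: "upper_gradient m v h" and a: "0 < (a::real)"
  shows "upper_gradient m (\<lambda>x. ereal a * u x + v x) (\<lambda>x. ennreal a * g x + h x)"
  unfolding upper_gradient_def
proof (intro conjI allI impI)
  have [measurable]: "g \<in> borel_measurable (mborel m)" "h \<in> borel_measurable (mborel m)"
    using u v by (auto simp: upper_gradient_def)
  show "(\<lambda>x. ennreal a * g x + h x) \<in> borel_measurable (mborel m)" by measurable
  fix \<gamma> l assume \<gamma>: "arc_curve m \<gamma> l"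
  define G where "G g = (\<integral>\<^sup>+ t. g (\<gamma> t) * indicator {0..l} t \<partial>lborel)" for g :: "'a \<Rightarrow> ennreal"
  have "continuous_map (top_of_set {0..l}) (mtopology_of m) \<gamma>"
    using \<gamma> by (simp add: arc_curve_def)
  \<comment> \<open>Additivity of the integral needs measurable integrands, so the curve must be
    measurable into the Borel sets of the metric space; preimages of open sets suffice.\<close>
  have meas: "\<gamma> \<in> restrict_space borel {0..l} \<rightarrow>\<^sub>M mborel m"
    unfolding mborel_def
  proof (rule measurable_measure_of)
    show "{U. openin (mtopology_of m) U} \<subseteq> Pow (mspace m)"
      using openin_subset by fastforce
    show "\<gamma> \<in> space (restrict_space borel {0..l}) \<rightarrow> mspace m"
      using \<gamma> by (auto simp: arc_curve_def)
    fix U assume "U \<in> {U. openin (mtopology_of m) U}"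
    then have "openin (top_of_set {0..l}) (\<gamma> -` U \<inter> {0..l})"
      using openin_continuous_map_preimage[of "top_of_set {0..l}" "mtopology_of m" \<gamma> U] \<open>continuous_map _ _ \<gamma>\<close>
      by (simp add: vimage_def Int_def conj_ac)
    then obtain T where "open T" "\<gamma> -` U \<inter> {0..l} = {0..l} \<inter> T"
      by (auto simp: openin_open)
    then show "\<gamma> -` U \<inter> space (restrict_space borel {0..l}) \<in> sets (restrict_space borel {0..l})"
      by (auto simp: sets_restrict_space)
  qed
  have Gm: "(\<lambda>t. k (\<gamma> t) * indicator {0..l} t) \<in> borel_measurable lborel"
    if "k \<in> borel_measurable (mborel m)" for k :: "'a \<Rightarrow> ennreal"
  proof -
    have "(\<lambda>t. k (\<gamma> t)) \<in> borel_measurable (restrict_space borel {0..l})"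
      using measurable_compose[OF meas that] .
    then show ?thesis by (subst (asm) borel_measurable_restrict_space_iff_ennreal) auto
  qed
  have "G (\<lambda>x. ennreal a * g x + h x)
      = (\<integral>\<^sup>+ t. ennreal a * (g (\<gamma> t) * indicator {0..l} t) + h (\<gamma> t) * indicator {0..l} t \<partial>lborel)"
    unfolding G_def by (intro nn_integral_cong) (auto split: split_indicator)
  also have "\<dots> = ennreal a * G g + G h"
    unfolding G_def using Gm[of g] Gm[of h]
    by (subst nn_integral_add) (auto simp: nn_integral_cmult)
  finally have eq: "enn2ereal (G (\<lambda>x. ennreal a * g x + h x)) = ereal a * enn2ereal (G g) + enn2ereal (G h)"
    using a by (simp add: plus_ennreal.rep_eq times_ennreal.rep_eq enn2ereal_ennreal)
  \<comment> \<open>If \<open>x\<close> and \<open>y\<close> are finite, all four values are real,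
    since \<infinity> - \<infinity> has absolute value \<infinity>. If one of them is infinite, so
    is the right side, because \<open>a > 0\<close>.\<close>
  have arith: "\<bar>(ereal a * p + q) - (ereal a * p' + q')\<bar> \<le> ereal a * x + y"
    if le: "\<bar>p - p'\<bar> \<le> x" "\<bar>q - q'\<bar> \<le> y" for p q p' q' x y :: ereal
  proof (cases "x = \<infinity> \<or> y = \<infinity>")
    case True
    have "0 \<le> x" "0 \<le> y" using that by (meson abs_ereal_pos order_trans)+
    then have "ereal a * x + y = \<infinity>" using True a by (cases x; cases y) auto
    then show ?thesis using ereal_less_eq(1) by metis
  next
    case False
    have "0 \<le> x" "0 \<le> y" using that by (meson abs_ereal_pos order_trans)+
    then obtain x' y' where xy: "x = ereal x'" "y = ereal y'"
      using False by (cases x; cases y) auto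
    have real: "\<exists>R R'. r = ereal R \<and> r' = ereal R'" if "\<bar>r - r'\<bar> \<le> ereal z" for r r' z
      using that by (cases r; cases r') auto
    obtain P Q P' Q' where PQ: "p = ereal P" "q = ereal Q" "p' = ereal P'" "q' = ereal Q'"
      using real[OF le(1)[unfolded xy(1)]] real[OF le(2)[unfolded xy(2)]] by auto
    have "a * P + Q - (a * P' + Q') = a * (P - P') + (Q - Q')" by (simp add: algebra_simps)
    then have "\<bar>a * P + Q - (a * P' + Q')\<bar> \<le> a * \<bar>P - P'\<bar> + \<bar>Q - Q'\<bar>"
      using a abs_triangle_ineq[of "a * (P - P')" "Q - Q'"] by (simp add: abs_mult)
    also have "\<dots> \<le> a * x' + y'"
      using le a unfolding xy PQ by (intro add_mono mult_left_mono) auto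
    finally show ?thesis unfolding xy PQ by simp
  qed
  show "\<bar>ereal a * u (\<gamma> 0) + v (\<gamma> 0) - (ereal a * u (\<gamma> l) + v (\<gamma> l))\<bar>
      \<le> enn2ereal (\<integral>\<^sup>+ t. (ennreal a * g (\<gamma> t) + h (\<gamma> t)) * indicator {0..l} t \<partial>lborel)"
    using eq arith u v \<gamma> unfolding G_def upper_gradient_def by auto
qed

section \<open>Capacity: near-optimal pairs and quasi-subadditivity\<close>

text \<open>Any single pair of a function and an upper gradient bounds the capacity; membership in
  the Newtonian space need not be checked, as an infinite right side makes the bound
  trivial.\<close>

lemma cap_le:
  assumes "u \<in> borel_measurable M" "upper_gradient m u g" "\<And>x. x \<in> E \<Longrightarrow> 1 \<le> u x"
  shows "cap m M nX E \<le> nX u + nX (\<lambda>x. enn2ereal (g x))"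
proof -
  have le: "N1norm m nX u \<le> nX u + nX (\<lambda>x. enn2ereal (g x))"
    unfolding N1norm_def using assms(2) by (intro add_left_mono INF_lower) auto
  show ?thesis
  proof (cases "nX u + nX (\<lambda>x. enn2ereal (g x)) = \<infinity>")
    case False
    then have "inN1 m M nX u"
      using le assms(1) by (auto simp: inN1_def less_top intro: le_less_trans)
    then have "cap m M nX E \<le> N1norm m nX u"
      unfolding cap_def using assms(3) by (intro INF_lower) auto
    then show ?thesis using le by (rule order_trans)
  next
    case True
    then show ?thesis by (metis infinity_ennreal_def top_greatest)
  qed
qed

text \<open>Both infima, over functions and over upper gradients, are undercut at once. Replacing
  \<open>u\<close> by its absolute value keeps the gradient and does not increase the norm.\<close>

lemma cap_lessE:
  assumes "cap m M nX E < t"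
  obtains u g where "u \<in> borel_measurable M" "upper_gradient m u g"
    "\<And>x. 0 \<le> u x" "\<And>x. x \<in> E \<Longrightarrow> 1 \<le> u x" "nX u + nX (\<lambda>x. enn2ereal (g x)) < t"
proof -
  obtain u where u: "inN1 m M nX u" "\<And>x. x \<in> E \<Longrightarrow> 1 \<le> u x" "N1norm m nX u < t"
    using assms unfolding cap_def INF_less_iff by blast
  have meas[measurable]: "u \<in> borel_measurable M" using u by (simp add: inN1_def)
  have "\<exists>g. upper_gradient m u g \<and> nX u + nX (\<lambda>x. enn2ereal (g x)) < t"
  proof (rule ccontr)
    \<comment> \<open>Otherwise \<open>t - nX u\<close> is a lower bound for the norms of all upper
      gradients, and adding the finite \<open>nX u\<close> gives
      \<open>t \<le> N1norm m nX u\<close>.\<close>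
    assume "\<not> ?thesis"
    then have "t \<le> nX u + nX (\<lambda>x. enn2ereal (g x))" if "upper_gradient m u g" for g
      using that not_less by blast
    moreover have fin: "nX u \<noteq> top"
      using u(1) by (auto simp: inN1_def N1norm_def)
    ultimately have "t - nX u \<le> nX (\<lambda>x. enn2ereal (g x))" if "upper_gradient m u g" for g
      using that by (simp add: ennreal_minus_le_iff)
    then have "t - nX u \<le> (INF g \<in> {g. upper_gradient m u g}. nX (\<lambda>x. enn2ereal (g x)))"
      by (intro INF_greatest) auto
    then have "t \<le> N1norm m nX u"
      by (simp add: N1norm_def ennreal_minus_le_iff)
    then show False using u(3) by simp
  qed
  then obtain g where g: "upper_gradient m u g" "nX u + nX (\<lambda>x. enn2ereal (g x)) < t" by blast
  show thesis
  proof (rule that[of "\<lambda>x. \<bar>u x\<bar>" g])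
    have "nX (\<lambda>x. \<bar>u x\<bar>) \<le> nX u" by (rule norm_mono) auto
    then show "nX (\<lambda>x. \<bar>u x\<bar>) + nX (\<lambda>x. enn2ereal (g x)) < t"
      using g(2) by (meson add_right_mono le_less_trans)
    show "1 \<le> \<bar>u x\<bar>" if "x \<in> E" for x
      using u(2)[OF that] by (cases "u x") auto
  qed (use g in \<open>auto intro: upper_gradient_abs\<close>)
qed

text \<open>The sum of near-optimal nonnegative functions for \<open>E\<close> and \<open>F\<close>
  is admissible for the union; the factor \<open>c\<close> comes from the quasi-triangle inequality,
  applied to functions and gradients.\<close>

lemma cap_Un: "cap m M nX (E \<union> F) \<le> ennreal c * (cap m M nX E + cap m M nX F)"
proof (cases "cap m M nX E = \<infinity> \<or> cap m M nX F = \<infinity>")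
  case True
  then show ?thesis using c_ge_1 by (auto simp: ennreal_mult_eq_top_iff ennreal_top_mult ennreal_mult_top)
next
  case False
  show ?thesis
  proof (rule dense_ge)
    fix t assume t: "ennreal c * (cap m M nX E + cap m M nX F) < t"
    have c: "0 < c" using c_ge_1 by simp
    have "\<exists>e::real>0. ennreal c * (cap m M nX E + ennreal e + (cap m M nX F + ennreal e)) < t"
    proof -
      obtain x y where xy: "cap m M nX E = ennreal x" "cap m M nX F = ennreal y" "0 \<le> x" "0 \<le> y"
        using False by (cases "cap m M nX E"; cases "cap m M nX F") auto
      obtain z where z: "c * (x + y) < z" "ennreal z \<le> t" "0 \<le> z"
      proof (cases t)
        case (real r)
        then show ?thesis using that[of r] t xy c
          by (auto simp: ennreal_mult[symmetric] ennreal_plus[symmetric] ennreal_less_iff simp del: ennreal_plus)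
      next
        case top
        then show ?thesis using that[of "c * (x + y) + 1"] xy c by auto
      qed
      \<comment> \<open>\<open>z\<close> is a finite stand-in for \<open>t\<close>. This
        \<open>e\<close> makes the total error \<open>2 * c * e\<close> half of the gap between
        \<open>c * (x + y)\<close> and \<open>z\<close>.\<close>
      define e where "e = (z - c * (x + y)) / (4 * c)"
      have e: "e > 0" using z c by (auto simp: e_def)
      have "c * (x + e + (y + e)) = c * (x + y) + (z - c * (x + y)) / 2"
        using c by (simp add: e_def field_simps)
      then have "c * (x + e + (y + e)) < z" using z by (simp add: field_simps)
      then have "ennreal (c * (x + e + (y + e))) < ennreal z"
        using e xy c by (simp add: ennreal_less_iff)
      also have "ennreal (c * (x + e + (y + e))) = ennreal c * (ennreal x + ennreal e + (ennreal y + ennreal e))"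
        using e xy(3,4) c by (simp only: ennreal_mult ennreal_plus add_nonneg_nonneg less_imp_le)
      finally show ?thesis using z(2) e xy(1,2)
        by (intro exI[of _ e]) auto
    qed
    then obtain e :: real where e: "e > 0"
      "ennreal c * (cap m M nX E + ennreal e + (cap m M nX F + ennreal e)) < t" by blast
    have "cap m M nX E < cap m M nX E + ennreal e" "cap m M nX F < cap m M nX F + ennreal e"
      using False e(1) by (auto simp: ennreal_less_zero_iff)
    then obtain u g v h where
        u[measurable]: "u \<in> borel_measurable M" "upper_gradient m u g" "\<And>x. 0 \<le> u x" "\<And>x. x \<in> E \<Longrightarrow> 1 \<le> u x"
          "nX u + nX (\<lambda>x. enn2ereal (g x)) < cap m M nX E + ennreal e"
        and v[measurable]: "v \<in> borel_measurable M" "upper_gradient m v h" "\<And>x. 0 \<le> v x" "\<And>x. x \<in> F \<Longrightarrow> 1 \<le> v x"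
          "nX v + nX (\<lambda>x. enn2ereal (h x)) < cap m M nX F + ennreal e"
      by (metis cap_lessE)
    have ge: "1 \<le> u x + v x" if "x \<in> E \<union> F" for x
    proof (cases "x \<in> E")
      case True then show ?thesis using u(3,4)[of x] v(3)[of x] add_mono[of 1 "u x" 0 "v x"] by auto
    next
      case False then show ?thesis using that u(3)[of x] v(3,4)[of x] add_mono[of 0 "u x" 1 "v x"] by auto
    qed
    have gm[measurable]: "(\<lambda>x. enn2ereal (g x)) \<in> borel_measurable M" "(\<lambda>x. enn2ereal (h x)) \<in> borel_measurable M"
      using u v measurable_mborel by (auto simp: upper_gradient_def)
    have "upper_gradient m (\<lambda>x. u x + v x) (\<lambda>x. g x + h x)"
      using upper_gradient_scale_add[OF u(2) v(2), of 1] by (simp flip: one_ereal_def)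
    then have "cap m M nX (E \<union> F) \<le> nX (\<lambda>x. u x + v x) + nX (\<lambda>x. enn2ereal (g x + h x))"
      using ge by (intro cap_le) auto
    also have "\<dots> \<le> ennreal c * (nX u + nX v) + ennreal c * (nX (\<lambda>x. enn2ereal (g x)) + nX (\<lambda>x. enn2ereal (h x)))"
      unfolding plus_ennreal.rep_eq by (intro add_mono norm_add) auto
    also have "\<dots> = ennreal c * ((nX u + nX (\<lambda>x. enn2ereal (g x))) + (nX v + nX (\<lambda>x. enn2ereal (h x))))"
      by (simp add: algebra_simps)
    also have "\<dots> \<le> ennreal c * (cap m M nX E + ennreal e + (cap m M nX F + ennreal e))"
      using add_mono[OF less_imp_le[OF u(5)] less_imp_le[OF v(5)]] by (intro mult_left_mono) auto
    also have "\<dots> < t" by (rule e)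
    finally show "cap m M nX (E \<union> F) \<le> t" by simp
  qed
qed

text \<open>The form in which exceptional sets are joined: the factor \<open>c\<close> is paid for
  in advance, with half of \<open>e / c\<close> allotted to each set.\<close>

lemma cap_Un_less:
  assumes "cap m M nX E < ennreal (e / (2 * c))" "cap m M nX F < ennreal (e / (2 * c))" "0 < e"
  shows "cap m M nX (E \<union> F) < ennreal e"
proof -
  have c: "0 < c" using c_ge_1 by simp
  have "cap m M nX E + cap m M nX F < ennreal (e / (2 * c)) + ennreal (e / (2 * c))"
    using assms by (rule_tac add_strict_mono) auto
  also have "\<dots> = ennreal (e / c)"
    using assms(3) c by (simp flip: ennreal_plus add: field_simps)
  finally have lt: "cap m M nX E + cap m M nX F < ennreal (e / c)" .
  then have "ennreal c * (cap m M nX E + cap m M nX F) < ennreal c * ennreal (e / c)"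
    using c by (intro ennreal_mult_strict_left_mono) auto
  also have "\<dots> = ennreal e" using assms(3) c by (simp flip: ennreal_mult)
  finally show ?thesis using cap_Un by (rule le_less_trans[rotated])
qed

end

section \<open>The implications\<close>

context qbfl
begin

section \<open>Implications obtained by changing exceptional sets\<close>

lemma cap_empty: "cap m M nX {} = 0"
proof -
  have "cap m M nX {} \<le> nX (\<lambda>x. 0) + nX (\<lambda>x. enn2ereal 0)"
    by (rule cap_le) (auto simp: upper_gradient_def zero_ereal_def[symmetric])
  also have "\<dots> = 0" by (simp add: norm_zero_iff zero_ennreal.rep_eq)
  finally show ?thesis by simp
qed

text \<open>\<open>E\<close> itself serves as exceptional set for every \<epsilon>. The value
  \<infinity> is chosen because it is forbidden off an exceptional set.\<close>

lemma weakly_quasicont_indicator: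
  assumes "E \<subseteq> mspace m" "cap m M nX E = 0"
  shows "weakly_quasicont m M nX (\<lambda>x. if x \<in> E then \<infinity> else 0)"
  unfolding weakly_quasicont_def
proof (intro allI impI exI[of _ E] conjI)
  show "continuous_map (subtopology (mtopology_of m) (mspace m - E)) euclideanreal
      (\<lambda>x. real_of_ereal (if x \<in> E then \<infinity> else 0))"
    by (rule continuous_map_eq[of _ _ "\<lambda>x. 0"]) auto
qed (use assms in auto)

text \<open>An exceptional set of capacity below \<open>e / C\<close> has an open superset of
  capacity below \<open>e\<close>, and restricting further preserves continuity.\<close>

lemma C_imp_D: "propC m M nX \<Longrightarrow> propD m M nX"
proof -
  assume "propC m M nX"
  then obtain C where C: "1 \<le> C" "quasiouter_c m M nX C" by (auto simp: propC_def)
  show "propD m M nX"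
    unfolding propD_def quasicont_def
  proof (intro allI impI)
    fix u and e :: real
    assume u: "weakly_quasicont m M nX u" and "0 < e"
    then have "0 < e / C" using C by auto
    then obtain E where E: "E \<subseteq> mspace m" "cap m M nX E < ennreal (e / C)"
        "\<forall>x\<in>mspace m - E. \<bar>u x\<bar> \<noteq> \<infinity>"
        "continuous_map (subtopology (mtopology_of m) (mspace m - E)) euclideanreal (\<lambda>x. real_of_ereal (u x))"
      using u unfolding weakly_quasicont_def by blast
    have "(INF G \<in> {G. openin (mtopology_of m) G \<and> E \<subseteq> G}. cap m M nX G) \<le> ennreal C * cap m M nX E"
      using C E unfolding quasiouter_c_def by blast
    also have "\<dots> < ennreal C * ennreal (e / C)"
      using E C by (intro ennreal_mult_strict_left_mono) auto
    also have "\<dots> = ennreal e" using C \<open>0 < e\<close> by (simp flip: ennreal_mult)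
    finally obtain G where G: "openin (mtopology_of m) G" "E \<subseteq> G" "cap m M nX G < ennreal e"
      unfolding INF_less_iff by blast
    have "continuous_map (subtopology (mtopology_of m) (mspace m - G)) euclideanreal (\<lambda>x. real_of_ereal (u x))"
      using E(4) G(2) by (rule_tac continuous_map_from_subtopology_mono) auto
    then show "\<exists>G. openin (mtopology_of m) G \<and> cap m M nX G < ennreal e \<and>
        (\<forall>x\<in>mspace m - G. \<bar>u x\<bar> \<noteq> \<infinity>) \<and>
        continuous_map (subtopology (mtopology_of m) (mspace m - G)) euclideanreal (\<lambda>x. real_of_ereal (u x))"
      using G E(3) by (metis DiffD1 DiffD2 DiffI subsetD)
  qed
qed

lemma D_imp_E: "propD m M nX \<Longrightarrow> propE m M nX"
  unfolding propE_def
proof (intro allI impI)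
  fix E and e :: real
  assume "propD m M nX" "E \<subseteq> mspace m" "cap m M nX E = 0" "0 < e"
  then have "quasicont m M nX (\<lambda>x. if x \<in> E then \<infinity> else 0)"
    using weakly_quasicont_indicator unfolding propD_def by blast
  with \<open>0 < e\<close> obtain G where G: "openin (mtopology_of m) G" "cap m M nX G < ennreal e"
      "\<forall>x\<in>mspace m - G. \<bar>if x \<in> E then \<infinity> else 0 :: ereal\<bar> \<noteq> \<infinity>"
    unfolding quasicont_def by blast
  \<comment> \<open>Finiteness off \<open>G\<close> forces every point where the test function is
    \<infinity> into \<open>G\<close>.\<close>
  then have "E \<subseteq> G" using \<open>E \<subseteq> mspace m\<close> by (force split: if_splits)
  with G show "\<exists>G. openin (mtopology_of m) G \<and> E \<subseteq> G \<and> cap m M nX G < ennreal e" by blast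
qed

text \<open>Passing from \<open>v\<close> to \<open>u\<close> costs only the set where they may
  differ. It is applied with that set of zero capacity for (G), and with an open superset of it for
  (A).\<close>

lemma quasicont_real_cong:
  assumes "continuous_map (subtopology (mtopology_of m) (mspace m - G)) euclideanreal (\<lambda>x. real_of_ereal (v x))"
    and "\<forall>x\<in>mspace m - E. v x = u x" and "\<forall>x\<in>mspace m - G. \<bar>v x\<bar> \<noteq> \<infinity>"
  shows "continuous_map (subtopology (mtopology_of m) (mspace m - (E \<union> G))) euclideanreal (\<lambda>x. real_of_ereal (u x))"
    and "\<forall>x\<in>mspace m - (E \<union> G). \<bar>u x\<bar> \<noteq> \<infinity>"
proof -
  have "continuous_map (subtopology (mtopology_of m) (mspace m - (E \<union> G))) euclideanreal (\<lambda>x. real_of_ereal (v x))"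
    using assms(1) by (rule continuous_map_from_subtopology_mono) auto
  then show "continuous_map (subtopology (mtopology_of m) (mspace m - (E \<union> G))) euclideanreal (\<lambda>x. real_of_ereal (u x))"
    using assms(2) by (elim continuous_map_eq) auto
  show "\<forall>x\<in>mspace m - (E \<union> G). \<bar>u x\<bar> \<noteq> \<infinity>"
    using assms(2,3) by (metis DiffD1 DiffD2 DiffI UnCI)
qed

lemma F_imp_G: "propF m M nX \<Longrightarrow> propG m M nX"
  unfolding propG_def weakly_quasicont_def
proof (intro allI impI)
  fix u and e :: real
  assume "propF m M nX" "inN1 m M nX u" "0 < e"
  then obtain v E where v: "quasicont m M nX v" and E: "E \<subseteq> mspace m" "cap m M nX E = 0"
      "\<forall>x\<in>mspace m - E. v x = u x"
    unfolding propF_def by blast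
  have "0 < e / (2 * c)" using \<open>0 < e\<close> c_ge_1 by auto
  with v obtain G where G: "openin (mtopology_of m) G" "cap m M nX G < ennreal (e / (2 * c))"
      "\<forall>x\<in>mspace m - G. \<bar>v x\<bar> \<noteq> \<infinity>"
      "continuous_map (subtopology (mtopology_of m) (mspace m - G)) euclideanreal (\<lambda>x. real_of_ereal (v x))"
    unfolding quasicont_def by blast
  have "cap m M nX (E \<union> G) < ennreal e"
    using E G \<open>0 < e\<close> \<open>0 < e / (2 * c)\<close> by (intro cap_Un_less) auto
  moreover have "E \<union> G \<subseteq> mspace m"
    using E(1) openin_subset[OF G(1)] by auto
  ultimately show "\<exists>E\<subseteq>mspace m. cap m M nX E < ennreal e \<and>
      (\<forall>x\<in>mspace m - E. \<bar>u x\<bar> \<noteq> \<infinity>) \<and>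
      continuous_map (subtopology (mtopology_of m) (mspace m - E)) euclideanreal (\<lambda>x. real_of_ereal (u x))"
    using quasicont_real_cong[OF G(4) E(3) G(3)] by blast
qed

lemma A_imp_F: "propA m M nX \<Longrightarrow> propF m M nX"
  unfolding propA_def propF_def using cap_empty by blast

text \<open>(E) covers the null set where \<open>u\<close> and \<open>v\<close> differ by an open
  set of small capacity, so the joint exceptional set is open.\<close>

lemma E_F_imp_A: "propE m M nX \<Longrightarrow> propF m M nX \<Longrightarrow> propA m M nX"
  unfolding propA_def quasicont_def
proof (intro allI impI)
  fix u and e :: real
  assume "propE m M nX" "propF m M nX" "inN1 m M nX u" "0 < e"
  then obtain v E where v: "quasicont m M nX v" and E: "E \<subseteq> mspace m" "cap m M nX E = 0"
      "\<forall>x\<in>mspace m - E. v x = u x"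
    unfolding propF_def by blast
  have e': "0 < e / (2 * c)" using \<open>0 < e\<close> c_ge_1 by auto
  with v obtain G where G: "openin (mtopology_of m) G" "cap m M nX G < ennreal (e / (2 * c))"
      "\<forall>x\<in>mspace m - G. \<bar>v x\<bar> \<noteq> \<infinity>"
      "continuous_map (subtopology (mtopology_of m) (mspace m - G)) euclideanreal (\<lambda>x. real_of_ereal (v x))"
    unfolding quasicont_def by blast
  obtain H where H: "openin (mtopology_of m) H" "E \<subseteq> H" "cap m M nX H < ennreal (e / (2 * c))"
    using \<open>propE m M nX\<close>[unfolded propE_def, rule_format, OF E(1,2) e'] by blast
  have "\<forall>x\<in>mspace m - H. v x = u x" using E(3) H(2) by blast
  moreover have "cap m M nX (H \<union> G) < ennreal e"
    using H G \<open>0 < e\<close> by (intro cap_Un_less) auto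
  ultimately show "\<exists>E. openin (mtopology_of m) E \<and> cap m M nX E < ennreal e \<and>
      (\<forall>x\<in>mspace m - E. \<bar>u x\<bar> \<noteq> \<infinity>) \<and>
      continuous_map (subtopology (mtopology_of m) (mspace m - E)) euclideanreal (\<lambda>x. real_of_ereal (u x))"
    using quasicont_real_cong[OF G(4) _ G(3), of H u] openin_Un[OF H(1) G(1)]
    by (intro exI[of _ "H \<union> G"] conjI) blast+
qed

lemma D_G_imp_A: "propD m M nX \<Longrightarrow> propG m M nX \<Longrightarrow> propA m M nX"
  unfolding propA_def propD_def propG_def by blast

lemma B_imp_C: "propB m M nX \<Longrightarrow> propC m M nX"
  unfolding propB_def propC_def by force

section \<open>From quasicontinuity to outer capacity\<close>

text \<open>The difference to \<open>u\<close> is at most \<open>u / (n + 1) + v n\<close>, whose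
  norm tends to 0. Continuity of the quasinorm then gives the exact limit, where the quasi-triangle
  inequality alone would leave a factor \<open>c\<close>.\<close>

lemma norm_perturb_tendsto:
  assumes u: "u \<in> borel_measurable M" "nX u < \<infinity>" "\<And>x. 0 \<le> u x"
    and v: "\<And>n. v n \<in> borel_measurable M" "\<And>n x. 0 \<le> v n x" "\<And>n. nX (v n) \<le> ennreal (inverse (real (Suc n)))"
  shows "(\<lambda>n. nX (\<lambda>x. ereal (1 + inverse (real (Suc n))) * u x + v n x)) \<longlonglongrightarrow> nX u"
proof (rule norm_continuous)
  have [measurable]: "u \<in> borel_measurable M" "\<And>n. v n \<in> borel_measurable M" by fact+
  note inv0 = LIMSEQ_inverse_real_of_nat
  show "inX M nX u" using u by (simp add: inX_def)
  show "inX M nX (\<lambda>x. ereal (1 + inverse (real (Suc n))) * u x + v n x)" for n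
  proof -
    have "nX (\<lambda>x. ereal (1 + inverse (real (Suc n))) * u x + v n x)
        \<le> ennreal c * (nX (\<lambda>x. ereal (1 + inverse (real (Suc n))) * u x) + nX (v n))"
      by (intro norm_add) auto
    also have "\<dots> < \<infinity>"
      using u(2) le_less_trans[OF v(3)[of n], of top]
      by (subst norm_scale) (auto simp: ennreal_mult_less_top)
    finally show ?thesis by (simp add: inX_def)
  qed
  have "nX (\<lambda>x. ereal (1 + inverse (real (Suc n))) * u x + v n x - u x)
      \<le> ennreal c * (ennreal (inverse (real (Suc n))) * nX u + ennreal (inverse (real (Suc n))))" for n
  proof -
    let ?i = "inverse (real (Suc n))"
    have "nX (\<lambda>x. ereal (1 + ?i) * u x + v n x - u x) \<le> nX (\<lambda>x. ereal ?i * u x + v n x)"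
    proof (rule norm_mono)
      \<comment> \<open>Cancelling \<open>u x\<close> is legitimate only where \<open>u\<close> is
        finite, which \<open>AE_finite\<close> grants almost everywhere.\<close>
      show "AE x in M. \<bar>ereal (1 + ?i) * u x + v n x - u x\<bar> \<le> \<bar>ereal ?i * u x + v n x\<bar>"
        using AE_finite[OF u(1,2)]
      proof eventually_elim
        case (elim x)
        then obtain r where r: "u x = ereal r" by auto
        have "ereal (1 + ?i) * u x + v n x - u x = ereal ?i * u x + v n x"
          unfolding r by (cases "v n x") (auto simp: algebra_simps)
        then show ?case by simp
      qed
    qed auto
    also have "\<dots> \<le> ennreal c * (nX (\<lambda>x. ereal ?i * u x) + nX (v n))"
      by (intro norm_add) auto
    also have "\<dots> \<le> ennreal c * (ennreal ?i * nX u + ennreal ?i)"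
      using v(3)[of n] by (subst norm_scale) (auto intro!: mult_left_mono add_left_mono)
    finally show ?thesis .
  qed
  moreover have "(\<lambda>n. ennreal c * (ennreal (inverse (real (Suc n))) * nX u + ennreal (inverse (real (Suc n))))) \<longlonglongrightarrow> 0"
  proof -
    obtain r where r: "nX u = ennreal r" "0 \<le> r" using u(2) by (cases "nX u") auto
    have "(\<lambda>n. c * (inverse (real (Suc n)) * r + inverse (real (Suc n)))) \<longlonglongrightarrow> c * (0 * r + 0)"
      by (intro tendsto_intros inv0)
    then have "(\<lambda>n. ennreal (c * (inverse (real (Suc n)) * r + inverse (real (Suc n))))) \<longlonglongrightarrow> ennreal 0"
      by (intro tendsto_ennrealI) simp
    moreover have "ennreal (c * (inverse (real (Suc n)) * r + inverse (real (Suc n))))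
        = ennreal c * (ennreal (inverse (real (Suc n))) * nX u + ennreal (inverse (real (Suc n))))" for n
      using r c_ge_1 by (simp add: ennreal_mult ennreal_plus)
    ultimately show ?thesis by simp
  qed
  ultimately show "(\<lambda>n. nX (\<lambda>x. ereal (1 + inverse (real (Suc n))) * u x + v n x - u x)) \<longlonglongrightarrow> 0"
    by (rule tendsto_sandwich[OF always_eventually always_eventually tendsto_const, OF allI allI, rotated]) simp
qed

lemma A_imp_B:
  assumes A: "propA m M nX" shows "propB m M nX"
  unfolding propB_def quasiouter_c_def
proof (intro allI impI)
  fix E assume "E \<subseteq> mspace m"
  have "(INF G \<in> {G. openin (mtopology_of m) G \<and> E \<subseteq> G}. cap m M nX G) \<le> cap m M nX E"
  proof (rule dense_ge)
    fix t assume "cap m M nX E < t"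
    then obtain u g where u: "u \<in> borel_measurable M" "upper_gradient m u g"
        "\<And>x. 0 \<le> u x" "\<And>x. x \<in> E \<Longrightarrow> 1 \<le> u x" "nX u + nX (\<lambda>x. enn2ereal (g x)) < t"
      by (metis cap_lessE)
    have fin: "nX u + nX (\<lambda>x. enn2ereal (g x)) < \<infinity>"
      using u(5) by (metis infinity_ennreal_def less_top order_less_le_trans top_greatest)
    have "N1norm m nX u \<le> nX u + nX (\<lambda>x. enn2ereal (g x))"
      unfolding N1norm_def using u(2) by (intro add_left_mono INF_lower) auto
    then have "inN1 m M nX u" using fin u(1) unfolding inN1_def by (blast intro: le_less_trans)
    then have qc: "quasicont m M nX u" using A by (simp add: propA_def)
    define i where "i n = inverse (real (Suc n))" for n
    have i: "0 < i n" for n by (simp add: i_def)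
    have "\<exists>V. openin (mtopology_of m) V \<and> cap m M nX V < ennreal (i n) \<and>
      (\<forall>x\<in>mspace m - V. \<bar>u x\<bar> \<noteq> \<infinity>) \<and>
      continuous_map (subtopology (mtopology_of m) (mspace m - V)) euclideanreal (\<lambda>x. real_of_ereal (u x))" for n
      using qc i[of n] unfolding quasicont_def by blast
    then obtain V where V: "\<And>n. openin (mtopology_of m) (V n)" "\<And>n. cap m M nX (V n) < ennreal (i n)"
      "\<And>n. \<forall>x\<in>mspace m - V n. \<bar>u x\<bar> \<noteq> \<infinity>"
      "\<And>n. continuous_map (subtopology (mtopology_of m) (mspace m - V n)) euclideanreal (\<lambda>x. real_of_ereal (u x))"
      by metis
    have "\<exists>v h. v \<in> borel_measurable M \<and> upper_gradient m v h \<and> (\<forall>x. 0 \<le> v x) \<and>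
       (\<forall>x\<in>V n. 1 \<le> v x) \<and> nX v + nX (\<lambda>x. enn2ereal (h x)) < ennreal (i n)" for n
      using cap_lessE[OF V(2)[of n]] by metis
    then obtain v h where v: "\<And>n. v n \<in> borel_measurable M" "\<And>n. upper_gradient m (v n) (h n)" "\<And>n x. 0 \<le> v n x"
       "\<And>n x. x \<in> V n \<Longrightarrow> 1 \<le> v n x" "\<And>n. nX (v n) + nX (\<lambda>x. enn2ereal (h n x)) < ennreal (i n)"
      by metis
    have gm: "(\<lambda>x. enn2ereal (g x)) \<in> borel_measurable M" "\<And>n. (\<lambda>x. enn2ereal (h n x)) \<in> borel_measurable M"
      using u v measurable_mborel by (auto simp: upper_gradient_def)
    \<comment> \<open>The cutoff lies below 1, so it admits all points of \<open>E\<close> off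
      \<open>V n\<close>; and above the cutoff \<open>(1 + i n) * u\<close> exceeds 1.\<close>
    define G where "G n = V n \<union> {x \<in> mspace m - V n. real_of_ereal (u x) \<in> {inverse (1 + i n)<..}}" for n
    have Gopen: "openin (mtopology_of m) (G n)" for n
    proof -
      have "openin (subtopology (mtopology_of m) (mspace m - V n))
          {x \<in> topspace (subtopology (mtopology_of m) (mspace m - V n)). real_of_ereal (u x) \<in> {inverse (1 + i n)<..}}"
        using V(4) by (rule openin_continuous_map_preimage) auto
      \<comment> \<open>Relative openness suffices: \<open>W\<close> can exceed the trace only
        inside \<open>V n\<close>, which belongs to \<open>G n\<close> anyway.\<close>
      then obtain W where "openin (mtopology_of m) W"
          "{x \<in> mspace m - V n. real_of_ereal (u x) \<in> {inverse (1 + i n)<..}} = W \<inter> (mspace m - V n)"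
        by (auto simp: openin_subtopology Int_absorb1)
      moreover from this have "G n = V n \<union> W"
        using openin_subset[of "mtopology_of m" W] unfolding G_def by auto
      ultimately show ?thesis using V(1) by auto
    qed
    have EG: "E \<subseteq> G n" for n
    proof
      fix x assume x: "x \<in> E"
      show "x \<in> G n"
      proof (cases "x \<in> V n")
        case False
        then have x': "x \<in> mspace m - V n" using x \<open>E \<subseteq> mspace m\<close> by auto
        then obtain r where r: "u x = ereal r" using V(3) by fastforce
        then have "1 \<le> r" using u(4)[OF x] by simp
        moreover have "inverse (1 + i n) < 1" using i[of n] by (simp add: inverse_less_1_iff)
        ultimately show ?thesis using r x' by (simp add: G_def)
      qed (simp add: G_def)
    qed
    have Gge: "1 \<le> ereal (1 + i n) * u x + v n x" if "x \<in> G n" for n x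
    proof (cases "x \<in> V n")
      case True
      have "0 \<le> ereal (1 + i n) * u x" using u(3)[of x] i[of n] by simp
      then show ?thesis using v(4)[OF True] add_mono[of 0 "ereal (1 + i n) * u x" 1 "v n x"] by simp
    next
      case False
      then have x: "x \<in> mspace m - V n" "inverse (1 + i n) < real_of_ereal (u x)"
        using that by (auto simp: G_def)
      then obtain r where r: "u x = ereal r" using V(3) by fastforce
      have "inverse (1 + i n) < r" using x r by simp
      then have "1 \<le> (1 + i n) * r" using i[of n] by (simp add: field_simps)
      then have "1 \<le> ereal (1 + i n) * u x" by (simp add: r)
      then show ?thesis using v(3)[of n x] add_mono[of 1 "ereal (1 + i n) * u x" 0 "v n x"] by simp
    qed
    have le: "cap m M nX (G n) \<le> nX (\<lambda>x. ereal (1 + i n) * u x + v n x)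
        + nX (\<lambda>x. ereal (1 + i n) * enn2ereal (g x) + enn2ereal (h n x))" for n
    proof -
      have "upper_gradient m (\<lambda>x. ereal (1 + i n) * u x + v n x) (\<lambda>x. ennreal (1 + i n) * g x + h n x)"
        using i[of n] by (intro upper_gradient_scale_add u(2) v(2)) linarith
      moreover have "(\<lambda>x. ereal (1 + i n) * u x + v n x) \<in> borel_measurable M"
        using u(1) v(1) by measurable
      ultimately have "cap m M nX (G n) \<le> nX (\<lambda>x. ereal (1 + i n) * u x + v n x)
          + nX (\<lambda>x. enn2ereal (ennreal (1 + i n) * g x + h n x))"
        using Gge by (intro cap_le) auto
      also have "(\<lambda>x. enn2ereal (ennreal (1 + i n) * g x + h n x)) = (\<lambda>x. ereal (1 + i n) * enn2ereal (g x) + enn2ereal (h n x))"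
        using i[of n] by (simp only: plus_ennreal.rep_eq times_ennreal.rep_eq enn2ereal_ennreal add_nonneg_nonneg less_imp_le zero_le_one)
      finally show ?thesis .
    qed
    have small: "nX (v n) \<le> ennreal (i n)" "nX (\<lambda>x. enn2ereal (h n x)) \<le> ennreal (i n)" for n
    proof -
      have "nX (v n) \<le> nX (v n) + nX (\<lambda>x. enn2ereal (h n x))"
        "nX (\<lambda>x. enn2ereal (h n x)) \<le> nX (v n) + nX (\<lambda>x. enn2ereal (h n x))" by simp_all
      then show "nX (v n) \<le> ennreal (i n)" "nX (\<lambda>x. enn2ereal (h n x)) \<le> ennreal (i n)"
        using v(5)[of n] by order+
    qed
    have fin': "nX u < \<infinity>" "nX (\<lambda>x. enn2ereal (g x)) < \<infinity>"
      using fin by auto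
    \<comment> \<open>The perturbation lemma is used twice: for \<open>u\<close> with
      \<open>v n\<close>, and for the upper gradients \<open>g\<close> with
      \<open>h n\<close>.\<close>
    have "(\<lambda>n. nX (\<lambda>x. ereal (1 + i n) * u x + v n x)
        + nX (\<lambda>x. ereal (1 + i n) * enn2ereal (g x) + enn2ereal (h n x))) \<longlonglongrightarrow> nX u + nX (\<lambda>x. enn2ereal (g x))"
      unfolding i_def
      by (intro tendsto_add norm_perturb_tendsto) (use u v gm fin' small in \<open>auto simp: i_def\<close>)
    then have "\<forall>\<^sub>F n in sequentially. nX (\<lambda>x. ereal (1 + i n) * u x + v n x)
        + nX (\<lambda>x. ereal (1 + i n) * enn2ereal (g x) + enn2ereal (h n x)) < t"
      using u(5) by (rule order_tendstoD)
    then obtain n where "nX (\<lambda>x. ereal (1 + i n) * u x + v n x)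
        + nX (\<lambda>x. ereal (1 + i n) * enn2ereal (g x) + enn2ereal (h n x)) < t"
      using eventually_happens by force
    then have "cap m M nX (G n) \<le> t" using le[of n] by order
    then show "(INF G \<in> {G. openin (mtopology_of m) G \<and> E \<subseteq> G}. cap m M nX G) \<le> t"
      using Gopen[of n] EG[of n] by (intro INF_lower2[of "G n"]) auto
  qed
  then show "(INF G \<in> {G. openin (mtopology_of m) G \<and> E \<subseteq> G}. cap m M nX G) \<le> ennreal 1 * cap m M nX E"
    by simp
qed

end

section \<open>A space without rectifiable curves\<close>

text \<open>The distance to the starting point is continuous along the curve, so its range is
  connected and countable, hence a single value. The curve is constant and has length 0, against the
  arc length \<open>l > 0\<close>.\<close>

lemma countable_no_arc_curve:
  assumes "countable (mspace m)"
  shows "\<not> arc_curve m \<gamma> l"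
proof
  assume \<gamma>: "arc_curve m \<gamma> l"
  then have l: "0 < l" and in_space: "\<And>t. t \<in> {0..l} \<Longrightarrow> \<gamma> t \<in> mspace m"
    and cont: "continuous_map (top_of_set {0..l}) (mtopology_of m) \<gamma>"
    and len: "curve_length m \<gamma> 0 l = ennreal l"
    by (auto simp: arc_curve_def)
  define f where "f t = mdist m (\<gamma> 0) (\<gamma> t)" for t
  have "continuous_map (top_of_set {0..l}) euclideanreal f"
    unfolding f_def using cont in_space[of 0] l by (intro continuous_map_mdist) auto
  then have "continuous_on {0..l} f" by simp
  then have conn: "connected (f ` {0..l})" by (intro connected_continuous_image) auto
  have "f ` {0..l} \<subseteq> mdist m (\<gamma> 0) ` mspace m"
    using in_space by (auto simp: f_def)
  then have ctb: "countable (f ` {0..l})"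
    using assms by (meson countable_image countable_subset)
  have "\<gamma> t = \<gamma> 0" if "t \<in> {0..l}" for t
  proof (rule ccontr)
    assume "\<gamma> t \<noteq> \<gamma> 0"
    moreover have "mdist m (\<gamma> 0) (\<gamma> 0) = 0" using in_space[of 0] l by simp
    ultimately have "f t \<noteq> f 0" using in_space[OF that] in_space[of 0] l
      unfolding f_def by (metis atLeastAtMost_iff less_imp_le mdist_zero order_refl)
    then have "uncountable (f ` {0..l})"
      using that l by (intro connected_uncountable[OF conn, of "f t" "f 0"]) auto
    then show False using ctb by simp
  qed
  \<comment> \<open>Monotone partitions from 0 to \<open>l\<close> stay in the interval on which the
    curve is constant, so every summand of every length sum vanishes.\<close>
  moreover have "\<tau> i \<in> {0..l}"
    if "\<tau> 0 = 0" "\<tau> n = l" "\<forall>i<n. \<tau> i \<le> \<tau> (Suc i)" "i \<le> n" for \<tau> :: "nat \<Rightarrow> real" and n i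
  proof -
    have "\<tau> a \<le> \<tau> b" if "a \<le> b" "b \<le> n" for a b
      using that
    proof (induction b rule: dec_induct)
      case (step j)
      then show ?case using \<open>\<forall>i<n. \<tau> i \<le> \<tau> (Suc i)\<close> order_trans[of "\<tau> a" "\<tau> j" "\<tau> (Suc j)"] by simp
    qed simp
    from this[of 0 i] this[of i n] that show ?thesis by auto
  qed
  ultimately have "mdist m (\<gamma> (\<tau> i)) (\<gamma> (\<tau> (Suc i))) = 0"
    if "\<tau> 0 = 0" "\<tau> n = l" "\<forall>i<n. \<tau> i \<le> \<tau> (Suc i)" "i < n" for \<tau> :: "nat \<Rightarrow> real" and n i
    using that in_space[of 0] l by (metis Suc_leI atLeastAtMost_iff less_imp_le mdist_zero order_refl)
  then have "curve_length m \<gamma> 0 l \<le> 0"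
    unfolding curve_length_def by (intro SUP_least) auto
  then show False using len l by simp
qed

section \<open>The comb as a metric space and its topology\<close>

text \<open>A pair \<open>(k, n)\<close> is stored in the coordinates 0 and 1 of a function, to fit
  the type \<open>nat \<Rightarrow> real\<close> of the counterexamples; all later coordinates
  repeat \<open>n\<close>.\<close>

definition comb_point :: "nat \<Rightarrow> nat \<Rightarrow> nat \<Rightarrow> real" where
  "comb_point k n j = (if j = 0 then real k else real n)"

definition comb_points :: "(nat \<Rightarrow> real) set" where
  "comb_points = {comb_point k n |k n. True}"

text \<open>Since \<open>inverse 0 = 0\<close>, the point \<open>comb_point k 0\<close> has distance \<open>1/n\<close> from \<open>comb_point k n\<close>.\<close>
definition comb_dist :: "(nat \<Rightarrow> real) \<Rightarrow> (nat \<Rightarrow> real) \<Rightarrow> real" where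
  "comb_dist x y = (if x = y then 0 else if x 0 \<noteq> y 0 then 1 else max (inverse \<bar>x 1\<bar>) (inverse \<bar>y 1\<bar>))"

definition comb :: "(nat \<Rightarrow> real) metric" where
  "comb = metric (comb_points, comb_dist)"

lemma comb_point_simps [simp]: "comb_point k n 0 = real k" "comb_point k n (Suc 0) = real n"
  by (simp_all add: comb_point_def)

lemma comb_point_eq_iff [simp]: "comb_point k n = comb_point k' n' \<longleftrightarrow> k = k' \<and> n = n'"
proof
  assume "comb_point k n = comb_point k' n'"
  then have "comb_point k n 0 = comb_point k' n' 0" "comb_point k n 1 = comb_point k' n' 1" by simp_all
  then show "k = k' \<and> n = n'" by simp
qed simp

lemma comb_point_in [simp]: "comb_point k n \<in> comb_points"
  by (auto simp: comb_points_def)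

lemma inverse_real_le_1: "inverse (real n) \<le> 1"
  by (cases n) (auto simp: field_simps)

lemma comb_dist_point:
  "comb_dist (comb_point k n) (comb_point k' n') =
    (if k = k' \<and> n = n' then 0 else if k \<noteq> k' then 1 else max (inverse (real n)) (inverse (real n')))"
  by (simp add: comb_dist_def)

text \<open>No distance exceeds 1, so a detour through another sequence is never shorter. Within one
  sequence distinct points are at distance \<open>max (1/i) (1/k)\<close>, at most
  \<open>1/i + 1/k\<close>, and this is positive since not both indices are 0.\<close>

lemma Metric_space_comb: "Metric_space comb_points comb_dist"
proof
  fix x y z
  show "0 \<le> comb_dist x y"
    by (simp add: comb_dist_def le_max_iff_disj)
  show "comb_dist x y = comb_dist y x"
    by (auto simp: comb_dist_def max.commute)
  show "comb_dist x y = 0 \<longleftrightarrow> x = y" if "x \<in> comb_points" "y \<in> comb_points"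
    using that by (auto simp: comb_points_def comb_dist_point max_def split: if_splits)
  show "comb_dist x z \<le> comb_dist x y + comb_dist y z"
    if xyz: "x \<in> comb_points" "y \<in> comb_points" "z \<in> comb_points"
  proof -
    obtain a i b j c k where "x = comb_point a i" "y = comb_point b j" "z = comb_point c k"
      using xyz by (auto simp: comb_points_def)
    then show ?thesis
      using inverse_real_le_1[of i] inverse_real_le_1[of k]
        inverse_nonnegative_iff_nonnegative[of "real i"] inverse_nonnegative_iff_nonnegative[of "real j"]
        inverse_nonnegative_iff_nonnegative[of "real k"]
      by (auto simp: comb_dist_point max_def simp del: inverse_nonnegative_iff_nonnegative)
  qed
qed

lemma mspace_comb [simp]: "mspace comb = comb_points"
  and mdist_comb [simp]: "mdist comb = comb_dist"
  unfolding comb_def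
  by (simp_all add: Metric_space.mspace_metric[OF Metric_space_comb] Metric_space.mdist_metric[OF Metric_space_comb])

lemma countable_comb_points: "countable comb_points"
proof -
  have "comb_points = (\<lambda>(k, n). comb_point k n) ` UNIV"
    by (auto simp: comb_points_def)
  then show ?thesis by (metis countableI_type countable_image)
qed

lemma mball_comb_tail: "0 < r \<Longrightarrow> \<exists>N. \<forall>n\<ge>N. comb_point k n \<in> mball_of comb (comb_point k 0) r"
proof -
  assume "0 < r"
  then obtain N where N: "inverse (real (Suc N)) < r" using reals_Archimedean by blast
  have "comb_point k n \<in> mball_of comb (comb_point k 0) r" if "n \<ge> Suc N" for n
  proof -
    have "inverse (real n) \<le> inverse (real (Suc N))" using that by (intro le_imp_inverse_le) auto
    then show ?thesis using N \<open>0 < r\<close> by (auto simp: comb_dist_point)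
  qed
  then show ?thesis by blast
qed

text \<open>Points with \<open>n > 0\<close> are isolated, so openness is a condition at the limit
  points only.\<close>

lemma openin_comb_iff:
  "openin (mtopology_of comb) U \<longleftrightarrow>
    U \<subseteq> comb_points \<and> (\<forall>k. comb_point k 0 \<in> U \<longrightarrow> (\<exists>N. \<forall>n\<ge>N. comb_point k n \<in> U))"
proof -
  have "openin (mtopology_of comb) U \<longleftrightarrow> U \<subseteq> comb_points \<and> (\<forall>x\<in>U. \<exists>r>0. mball_of comb x r \<subseteq> U)"
    by (simp add: mtopology_of_def Metric_space.openin_mtopology mball_of_def Metric_space_comb Ball_def)
  also have "\<dots> \<longleftrightarrow> U \<subseteq> comb_points \<and> (\<forall>k. comb_point k 0 \<in> U \<longrightarrow> (\<exists>N. \<forall>n\<ge>N. comb_point k n \<in> U))"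
  proof (intro conj_cong refl iffI allI impI ballI)
    fix k assume "\<forall>x\<in>U. \<exists>r>0. mball_of comb x r \<subseteq> U" "comb_point k 0 \<in> U"
    then obtain r where "r > 0" "mball_of comb (comb_point k 0) r \<subseteq> U" by blast
    then show "\<exists>N. \<forall>n\<ge>N. comb_point k n \<in> U"
      using mball_comb_tail[of r k] by blast
  next
    fix x assume tail: "\<forall>k. comb_point k 0 \<in> U \<longrightarrow> (\<exists>N. \<forall>n\<ge>N. comb_point k n \<in> U)"
      and "U \<subseteq> comb_points" "x \<in> U"
    then obtain k n where x: "x = comb_point k n" by (auto simp: comb_points_def)
    show "\<exists>r>0. mball_of comb x r \<subseteq> U"
    proof (cases "n = 0")
      case True
      then obtain N where N: "\<forall>n\<ge>N. comb_point k n \<in> U" using tail x \<open>x \<in> U\<close> by blast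
      \<comment> \<open>Apart from its centre, this ball contains only points of the same sequence
        with index above \<open>Suc N\<close>.\<close>
      have "y \<in> U" if "y \<in> mball_of comb x (inverse (real (Suc N)))" for y
      proof -
        have "y \<in> comb_points" using that by simp
        then obtain k' n' where y: "y = comb_point k' n'" by (auto simp: comb_points_def)
        have d: "comb_dist x y < inverse (real (Suc N))" using that by simp
        have k: "k' = k"
          using d inverse_real_le_1[of "Suc N"] unfolding x y comb_dist_point by (auto split: if_splits)
        show ?thesis
        proof (cases "n' = 0")
          case False
          then have "inverse (real n') < inverse (real (Suc N))"
            using d k True unfolding x y comb_dist_point by (auto split: if_splits)
          then have "real (Suc N) < real n'"
            by (rule inverse_less_imp_less) (use False in simp)
          then show ?thesis using N y k by simp
        qed (use k x y True \<open>x \<in> U\<close> in simp)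
      qed
      then show ?thesis by (intro exI[of _ "inverse (real (Suc N))"]) auto
    next
      case False
      \<comment> \<open>Every other point is at distance at least \<open>1/n\<close> from
        \<open>x\<close>.\<close>
      have "y \<in> U" if "y \<in> mball_of comb x (inverse (real n))" for y
      proof -
        have "y \<in> comb_points" using that by simp
        then obtain k' n' where y: "y = comb_point k' n'" by (auto simp: comb_points_def)
        have d: "comb_dist x y < inverse (real n)" using that by simp
        then have "y = x"
          using inverse_real_le_1[of n] unfolding x y comb_dist_point by (auto split: if_splits)
        then show ?thesis using \<open>x \<in> U\<close> by simp
      qed
      then show ?thesis using False by (intro exI[of _ "inverse (real n)"]) auto
    qed
  qed
  finally show ?thesis .
qed

section \<open>Weighted supremum norms on the comb\<close>

definition abs_ennreal :: "ereal \<Rightarrow> ennreal" where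
  "abs_ennreal t = e2ennreal \<bar>t\<bar>"

lemma abs_ennreal_simps [simp]:
  "abs_ennreal 0 = 0" "abs_ennreal 1 = 1" "abs_ennreal \<infinity> = top" "abs_ennreal (ereal r) = ennreal \<bar>r\<bar>"
  by (simp_all add: abs_ennreal_def zero_ereal_def one_ereal_def)

lemma abs_ennreal_eq_0_iff [simp]: "abs_ennreal t = 0 \<longleftrightarrow> t = 0"
  by (cases t) (auto simp: abs_ennreal_def zero_ereal_def)

lemma abs_ennreal_mono: "\<bar>s\<bar> \<le> \<bar>t\<bar> \<Longrightarrow> abs_ennreal s \<le> abs_ennreal t"
  by (simp add: abs_ennreal_def e2ennreal_mono)

lemma abs_ennreal_mult: "abs_ennreal (ereal a * t) = ennreal \<bar>a\<bar> * abs_ennreal t"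
  by (cases t; cases "a = 0")
    (auto simp: abs_ennreal_def abs_mult ennreal_mult ennreal_mult_top zero_ereal_def)

lemma abs_ennreal_add: "abs_ennreal (s + t) \<le> abs_ennreal s + abs_ennreal t"
  by (cases s; cases t) (auto simp: abs_ennreal_def simp flip: ennreal_plus intro: ennreal_leI)

lemma abs_ennreal_suminf:
  assumes "\<And>n. 0 \<le> f n" shows "abs_ennreal (\<Sum>n. f n) = (\<Sum>n. abs_ennreal (f n))"
proof -
  have "f = (\<lambda>n. enn2ereal (e2ennreal (f n)))" using assms by (simp add: enn2ereal_e2ennreal)
  then obtain g where g: "f = (\<lambda>n. enn2ereal (g n))" by (rule that)
  show ?thesis unfolding g by (simp add: abs_ennreal_def)
qed

text \<open>The exact masses are irrelevant: they are summable and vanish precisely at the points that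
  the norm does not see.\<close>
definition comb_weight :: "ennreal \<Rightarrow> (nat \<Rightarrow> nat \<Rightarrow> ennreal) \<Rightarrow> nat \<Rightarrow> nat \<Rightarrow> ennreal" where
  "comb_weight \<alpha> \<beta> k n =
    (if n = 0 \<and> \<alpha> \<noteq> 0 \<or> \<beta> k n \<noteq> 0 then ennreal ((1/2) ^ prod_encode (k, n)) else 0)"

definition comb_measure :: "ennreal \<Rightarrow> (nat \<Rightarrow> nat \<Rightarrow> ennreal) \<Rightarrow> (nat \<Rightarrow> real) measure" where
  "comb_measure \<alpha> \<beta> = point_measure comb_points (\<lambda>x. comb_weight \<alpha> \<beta> (nat \<lfloor>x 0\<rfloor>) (nat \<lfloor>x 1\<rfloor>))"

text \<open>The index \<open>n = 0\<close> is included: there the term is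
  \<open>\<alpha> + \<beta> k 0\<close> times the value at the limit point. Thus \<alpha> couples a
  limit point to its neighbours, while \<open>\<beta> k 0\<close> weighs it alone.\<close>

definition comb_norm :: "ennreal \<Rightarrow> (nat \<Rightarrow> nat \<Rightarrow> ennreal) \<Rightarrow> ((nat \<Rightarrow> real) \<Rightarrow> ereal) \<Rightarrow> ennreal" where
  "comb_norm \<alpha> \<beta> u = (SUP (k, n). \<alpha> * abs_ennreal (u (comb_point k 0)) + \<beta> k n * abs_ennreal (u (comb_point k n)))"

lemma comb_norm_upper:
  "\<alpha> * abs_ennreal (u (comb_point k 0)) + \<beta> k n * abs_ennreal (u (comb_point k n)) \<le> comb_norm \<alpha> \<beta> u"
  unfolding comb_norm_def by (rule SUP_upper2[of "(k, n)"]) auto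

lemma comb_norm_least:
  assumes "\<And>k n. \<alpha> * abs_ennreal (u (comb_point k 0)) + \<beta> k n * abs_ennreal (u (comb_point k n)) \<le> C"
  shows "comb_norm \<alpha> \<beta> u \<le> C"
  unfolding comb_norm_def by (rule SUP_least) (use assms in auto)

text \<open>Positive weights for \<open>n > 0\<close> give these points positive mass, and hence
  every ball, since every ball contains such a point.\<close>

locale comb_lattice =
  fixes \<alpha> :: ennreal and \<beta> :: "nat \<Rightarrow> nat \<Rightarrow> ennreal"
  assumes \<beta>_pos: "\<And>k n. n > 0 \<Longrightarrow> \<beta> k n \<noteq> 0"
begin

abbreviation "MC \<equiv> comb_measure \<alpha> \<beta>"
abbreviation "nC \<equiv> comb_norm \<alpha> \<beta>"

lemma space_MC [simp]: "space MC = comb_points"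
  and sets_MC [simp]: "sets MC = Pow comb_points"
  by (simp_all add: comb_measure_def space_point_measure sets_point_measure)

lemma measurable_MC [simp]: "u \<in> borel_measurable MC"
  by (simp add: comb_measure_def)

lemma AE_MC: "(AE x in MC. Q x) \<longleftrightarrow> (\<forall>k n. (n = 0 \<and> \<alpha> \<noteq> 0 \<or> \<beta> k n \<noteq> 0) \<longrightarrow> Q (comb_point k n))"
proof -
  have "0 < comb_weight \<alpha> \<beta> (nat \<lfloor>comb_point k n 0\<rfloor>) (nat \<lfloor>comb_point k n 1\<rfloor>) \<longleftrightarrow> n = 0 \<and> \<alpha> \<noteq> 0 \<or> \<beta> k n \<noteq> 0"
    for k n by (simp add: comb_weight_def)
  then show ?thesis
    unfolding comb_measure_def AE_point_measure comb_points_def by blast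
qed

text \<open>Enumerated by \<open>prod_decode\<close>, the masses are dominated by a geometric
  series.\<close>

lemma emeasure_MC_finite: "emeasure MC A < \<infinity>"
proof -
  define w where "w x = comb_weight \<alpha> \<beta> (nat \<lfloor>x 0\<rfloor>) (nat \<lfloor>x 1\<rfloor>)" for x :: "nat \<Rightarrow> real"
  define p where "p j = (case prod_decode j of (k, n) \<Rightarrow> comb_point k n)" for j
  have "bij_betw p UNIV comb_points"
    unfolding bij_betw_def
  proof
    show "inj p"
      unfolding p_def inj_def by (auto split: prod.splits) (metis prod_decode_inverse)
    have "comb_point k n = p (prod_encode (k, n))" for k n by (simp add: p_def)
    then show "range p = comb_points"
      by (auto simp: comb_points_def) (auto simp: p_def split: prod.splits)
  qed
  then have "(\<integral>\<^sup>+x. w x \<partial>count_space comb_points) = (\<integral>\<^sup>+j. w (p j) \<partial>count_space UNIV)"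
    by (rule nn_integral_bij_count_space[symmetric])
  also have "\<dots> \<le> (\<integral>\<^sup>+j. ennreal ((1/2) ^ j) \<partial>count_space UNIV)"
  proof (intro nn_integral_mono)
    fix j
    obtain k n where "prod_decode j = (k, n)" by fastforce
    moreover from this have "j = prod_encode (k, n)" by (metis prod_decode_inverse)
    ultimately show "w (p j) \<le> ennreal ((1/2) ^ j)" by (simp add: w_def p_def comb_weight_def)
  qed
  also have "\<dots> = (\<Sum>j. ennreal ((1/2) ^ j))" by (rule nn_integral_count_space_nat)
  also have "\<dots> < top"
    by (intro ennreal_suminf_neq_top[THEN top.not_eq_extremum[THEN iffD1]] summable_geometric) auto
  finally have fin: "(\<integral>\<^sup>+x. w x \<partial>count_space comb_points) < top" .
  have "emeasure MC comb_points = (\<integral>\<^sup>+x. w x * indicator comb_points x \<partial>count_space comb_points)"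
    unfolding comb_measure_def point_measure_def by (subst emeasure_density) (auto simp: w_def)
  also have "\<dots> = (\<integral>\<^sup>+x. w x \<partial>count_space comb_points)"
    by (intro nn_integral_cong) auto
  finally have "emeasure MC comb_points < \<infinity>" using fin by simp
  moreover have "emeasure MC A \<le> emeasure MC (space MC)" by (rule emeasure_space)
  ultimately show ?thesis by (auto intro: le_less_trans)
qed

lemma emeasure_MC_ball: "x \<in> comb_points \<Longrightarrow> 0 < r \<Longrightarrow> 0 < emeasure MC (mball_of comb x r)"
proof (rule ccontr)
  assume x: "x \<in> comb_points" and r: "0 < r" and "\<not> 0 < emeasure MC (mball_of comb x r)"
  then have "mball_of comb x r \<in> null_sets MC" by (auto simp: null_sets_def)
  then have "AE y in MC. y \<notin> mball_of comb x r" by (rule AE_not_in)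
  then have nin: "comb_point k n \<notin> mball_of comb x r" if "n > 0" for k n
    using \<beta>_pos[OF that] by (simp add: AE_MC)
  obtain k n where kn: "x = comb_point k n" using x by (auto simp: comb_points_def)
  show False
  proof (cases "n = 0")
    case True
    then obtain N where "\<forall>n\<ge>N. comb_point k n \<in> mball_of comb x r"
      using mball_comb_tail[OF r, of k] kn by metis
    then have "comb_point k (Suc N) \<in> mball_of comb x r" by (metis le_SucI order_refl)
    then show False using nin by blast
  next
    case False
    then show False using nin[of n k] kn r by (simp add: comb_dist_def)
  qed
qed

lemma QBFL_comb: "QBFL comb MC nC 1"
  unfolding QBFL_def
proof (intro conjI ballI allI impI)
  have sb: "space (mborel comb) = comb_points"
    by (simp add: mborel_def space_measure_of_conv)
  show "sets (mborel comb) \<subseteq> sets MC"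
    using sets.sets_into_space[of _ "mborel comb"] sb by auto
  show "complete_measure MC"
    by standard (auto simp: null_sets_def)
  fix u v
  show "nC u = 0 \<longleftrightarrow> (AE x in MC. u x = 0)"
  proof
    assume "nC u = 0"
    then have "\<alpha> * abs_ennreal (u (comb_point k 0)) + \<beta> k n * abs_ennreal (u (comb_point k n)) \<le> 0" for k n
      using comb_norm_upper[of \<alpha> u k \<beta> n] by simp
    then show "AE x in MC. u x = 0" by (auto simp: AE_MC)
  next
    assume "AE x in MC. u x = 0"
    then have "\<alpha> = 0 \<or> u (comb_point k 0) = 0" "\<beta> k n = 0 \<or> u (comb_point k n) = 0" for k n
      unfolding AE_MC by blast+
    then have "nC u \<le> 0" by (intro comb_norm_least) simp
    then show "nC u = 0" by simp
  qed
  show "nC (\<lambda>x. ereal a * u x) = ennreal \<bar>a\<bar> * nC u" for a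
    unfolding comb_norm_def SUP_mult_left_ennreal abs_ennreal_mult
    by (intro SUP_cong refl) (auto simp: algebra_simps)
  show add: "nC (\<lambda>x. u x + v x) \<le> ennreal 1 * (nC u + nC v)" for u v
  proof -
    have "nC (\<lambda>x. u x + v x) \<le> nC u + nC v"
    proof (rule comb_norm_least)
      fix k n
      let ?t = "\<lambda>u. \<alpha> * abs_ennreal (u (comb_point k 0)) + \<beta> k n * abs_ennreal (u (comb_point k n))"
      have "?t (\<lambda>x. u x + v x) \<le> \<alpha> * (abs_ennreal (u (comb_point k 0)) + abs_ennreal (v (comb_point k 0)))
          + \<beta> k n * (abs_ennreal (u (comb_point k n)) + abs_ennreal (v (comb_point k n)))"
        by (intro add_mono mult_left_mono abs_ennreal_add) auto
      also have "\<dots> = ?t u + ?t v" by (simp add: algebra_simps)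
      also have "\<dots> \<le> nC u + nC v" by (intro add_mono comb_norm_upper)
      finally show "?t (\<lambda>x. u x + v x) \<le> nC u + nC v" .
    qed
    then show ?thesis by simp
  qed
  show mono: "nC u \<le> nC v" if "AE x in MC. \<bar>u x\<bar> \<le> \<bar>v x\<bar>" for u v
  proof -
    \<comment> \<open>At a null point the hypothesis gives nothing, but there the coefficients
      vanish. The same case split handles nonnegativity in the countable sum below.\<close>
    have "\<alpha> * abs_ennreal (u (comb_point k 0)) \<le> \<alpha> * abs_ennreal (v (comb_point k 0))" for k
      using that by (cases "\<alpha> = 0") (auto simp: AE_MC intro!: mult_left_mono abs_ennreal_mono)
    moreover have "\<beta> k n * abs_ennreal (u (comb_point k n)) \<le> \<beta> k n * abs_ennreal (v (comb_point k n))" for k n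
      using that by (cases "\<beta> k n = 0") (auto simp: AE_MC intro!: mult_left_mono abs_ennreal_mono)
    ultimately show ?thesis
      by (intro comb_norm_least order_trans[OF add_mono comb_norm_upper])
  qed
  show "nC (\<lambda>x. \<Sum>n. us n x) \<le> (\<Sum>n. ennreal (1 ^ Suc n) * nC (us n))"
    if "AE x in MC. \<forall>n. 0 \<le> us n x" for us
  proof (rule comb_norm_least)
    fix k n
    let ?t = "\<lambda>u. \<alpha> * abs_ennreal (u (comb_point k 0)) + \<beta> k n * abs_ennreal (u (comb_point k n))"
    have "\<alpha> * abs_ennreal (\<Sum>j. us j (comb_point k 0)) = (\<Sum>j. \<alpha> * abs_ennreal (us j (comb_point k 0)))"
      using that by (cases "\<alpha> = 0") (auto simp: AE_MC abs_ennreal_suminf)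
    moreover have "\<beta> k n * abs_ennreal (\<Sum>j. us j (comb_point k n)) = (\<Sum>j. \<beta> k n * abs_ennreal (us j (comb_point k n)))"
      using that by (cases "\<beta> k n = 0") (auto simp: AE_MC abs_ennreal_suminf)
    ultimately have "?t (\<lambda>x. \<Sum>n. us n x) = (\<Sum>j. ?t (us j))"
      using suminf_add[of "\<lambda>j. \<alpha> * abs_ennreal (us j (comb_point k 0))"
          "\<lambda>j. \<beta> k n * abs_ennreal (us j (comb_point k n))"] by (simp only: summableI)
    also have "\<dots> \<le> (\<Sum>j. nC (us j))" by (intro suminf_le comb_norm_upper) auto
    finally show "?t (\<lambda>x. \<Sum>n. us n x) \<le> (\<Sum>n. ennreal (1 ^ Suc n) * nC (us n))" by simp
  qed
  show "(\<lambda>n. nC (us n)) \<longlonglongrightarrow> nC u"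
    if "\<forall>n. inX MC nC (us n)" "inX MC nC u" "(\<lambda>n. nC (\<lambda>x. us n x - u x)) \<longlonglongrightarrow> 0" for us u
  proof -
    have le1: "nC (us n) \<le> nC u + nC (\<lambda>x. us n x - u x)" for n
    proof -
      \<comment> \<open>This survives infinite values because the sum \<infinity> + (-\<infinity>)
        is \<infinity> in \<open>ereal\<close>. With its counterpart below it yields both halves of
        the reverse triangle inequality for the norm.\<close>
      have "\<bar>s\<bar> \<le> \<bar>t + (s - t)\<bar>" for s t :: ereal by (cases s; cases t) auto
      then have "nC (us n) \<le> nC (\<lambda>x. u x + (us n x - u x))" by (intro mono) auto
      then show ?thesis using add[of u "\<lambda>x. us n x - u x"] by simp
    qed
    have le2: "nC u \<le> nC (us n) + nC (\<lambda>x. us n x - u x)" for n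
    proof -
      \<comment> \<open>Absolute values turn the difference \<open>t - (t - s)\<close> into a sum,
        to which \<open>add\<close> applies.\<close>
      have "\<bar>s\<bar> \<le> \<bar>\<bar>t\<bar> + \<bar>t - s\<bar>\<bar>" for s t :: ereal by (cases s; cases t) auto
      then have "nC u \<le> nC (\<lambda>x. \<bar>us n x\<bar> + \<bar>us n x - u x\<bar>)" by (intro mono) auto
      also have "\<dots> \<le> nC (\<lambda>x. \<bar>us n x\<bar>) + nC (\<lambda>x. \<bar>us n x - u x\<bar>)"
        using add[of "\<lambda>x. \<bar>us n x\<bar>" "\<lambda>x. \<bar>us n x - u x\<bar>"] by simp
      also have "\<dots> \<le> nC (us n) + nC (\<lambda>x. us n x - u x)" by (intro add_mono mono) auto
      finally show ?thesis .
    qed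
    have lim: "(\<lambda>n. nC u + nC (\<lambda>x. us n x - u x)) \<longlonglongrightarrow> nC u + 0"
      by (intro tendsto_add tendsto_const that)
    have lim': "(\<lambda>n. nC u - nC (\<lambda>x. us n x - u x)) \<longlonglongrightarrow> nC u - 0"
      using that by (intro tendsto_diff_ennreal tendsto_const) (auto simp: inX_def)
    show ?thesis
    proof (rule tendsto_sandwich)
      show "\<forall>\<^sub>F n in sequentially. nC u - nC (\<lambda>x. us n x - u x) \<le> nC (us n)"
        using le2 that(2) by (intro always_eventually) (auto simp: ennreal_minus_le_iff inX_def add.commute less_top)
      show "\<forall>\<^sub>F n in sequentially. nC (us n) \<le> nC u + nC (\<lambda>x. us n x - u x)"
        using le1 by simp
    qed (use lim lim' in auto)
  qed
qed (simp_all add: emeasure_MC_ball emeasure_MC_finite[simplified])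

sublocale qbfl comb MC nC 1
  by unfold_locales (rule QBFL_comb)

section \<open>Capacity on the comb\<close>

lemma N1norm_comb: "N1norm comb nC u = nC u"
proof -
  have "upper_gradient comb u (\<lambda>x. 0)"
    by (simp add: upper_gradient_def countable_no_arc_curve countable_comb_points)
  then have "(INF g \<in> {g. upper_gradient comb u g}. nC (\<lambda>x. enn2ereal (g x))) \<le> nC (\<lambda>x. enn2ereal 0)"
    by (intro INF_lower) auto
  also have "\<dots> = 0" by (simp add: norm_zero_iff zero_ennreal.rep_eq)
  finally show ?thesis by (simp add: N1norm_def)
qed

lemma inN1_comb: "inN1 comb MC nC u \<longleftrightarrow> nC u < \<infinity>"
  by (simp add: inN1_def N1norm_comb)

abbreviation "capC \<equiv> cap comb MC nC"

text \<open>By monotonicity of the norm no admissible function beats the indicator; if its norm is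
  infinite, the upper bound is trivial.\<close>

lemma capC_eq: "capC E = nC (\<lambda>x. if x \<in> E then 1 else 0)"
proof (rule antisym)
  let ?i = "\<lambda>x. if x \<in> E then 1 else 0 :: ereal"
  show "nC ?i \<le> capC E"
    unfolding cap_def N1norm_comb
  proof (rule INF_greatest)
    fix u assume "u \<in> {u. inN1 comb MC nC u \<and> (\<forall>x\<in>E. 1 \<le> u x)}"
    then have "1 \<le> u x" if "x \<in> E" for x using that by auto
    then have "\<bar>?i x\<bar> \<le> \<bar>u x\<bar>" for x
      using order_trans[of 1 "u x" "\<bar>u x\<bar>"] by (auto simp: abs_ereal_pos) (cases "u x"; fastforce)
    then show "nC ?i \<le> nC u" by (intro norm_mono) auto
  qed
  show "capC E \<le> nC ?i"
  proof (cases "nC ?i = top")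
    case False
    then show ?thesis unfolding cap_def
      by (intro INF_lower2[of ?i]) (auto simp: N1norm_comb inN1_comb less_top)
  qed simp
qed

lemma capC_upper:
  "\<alpha> * (if comb_point k 0 \<in> E then 1 else 0) + \<beta> k n * (if comb_point k n \<in> E then 1 else 0) \<le> capC E"
  using comb_norm_upper[of \<alpha> "\<lambda>x. if x \<in> E then 1 else 0" k \<beta> n] by (auto simp: capC_eq split: if_splits)

lemma capC_least:
  assumes "\<And>k n. \<alpha> * (if comb_point k 0 \<in> E then 1 else 0) + \<beta> k n * (if comb_point k n \<in> E then 1 else 0) \<le> C"
  shows "capC E \<le> C"
proof -
  have "nC (\<lambda>x. if x \<in> E then 1 else 0) \<le> C"
    by (rule comb_norm_least) (use assms in \<open>auto simp: if_distrib cong: if_cong\<close>)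
  then show ?thesis by (simp add: capC_eq)
qed

end

section \<open>Counterexamples\<close>

lemma comb_pointsE:
  assumes "x \<in> comb_points"
  obtains k n where "x = comb_point k n"
  using assms by (auto simp: comb_points_def)

context comb_lattice
begin

section \<open>Criteria on the weights for the individual properties\<close>

lemma capC_ge_tooth:
  assumes "comb_point k n \<in> E" shows "\<beta> k n \<le> capC E"
proof -
  have "\<beta> k n \<le> \<alpha> * (if comb_point k 0 \<in> E then 1 else 0) + \<beta> k n" by simp
  also have "\<dots> \<le> capC E" using capC_upper[of k E n] assms by simp
  finally show ?thesis .
qed

lemma capC_ge_limit: "comb_point k 0 \<in> E \<Longrightarrow> \<alpha> \<le> capC E"
  using capC_upper[of k E 0] by (auto intro: order_trans[rotated])

lemma capC_ge_both: "comb_point k 0 \<in> E \<Longrightarrow> comb_point k n \<in> E \<Longrightarrow> \<alpha> + \<beta> k n \<le> capC E"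
  using capC_upper[of k E n] by simp

text \<open>Every neighbourhood of a limit point contains isolated points of its sequence, so their
  weights enter its capacity. All failures of openness below rest on this.\<close>

lemma openin_comb_tail:
  assumes "openin (mtopology_of comb) G" "comb_point k 0 \<in> G"
  obtains n where "0 < n" "comb_point k n \<in> G"
proof -
  obtain N where "\<forall>n\<ge>N. comb_point k n \<in> G" using assms by (auto simp: openin_comb_iff)
  then show thesis using that[of "Suc N"] by simp
qed

text \<open>A set of capacity below 1 misses the whole \<open>k\<close>-th sequence, along which the
  indicator of the limit point jumps from 0 to 1.\<close>

lemma not_propG_if:
  assumes \<beta>: "\<And>n. 1 \<le> \<beta> k n" and fin: "\<alpha> \<noteq> top" "\<beta> k 0 \<noteq> top"
  shows "\<not> propG comb MC nC"
proof
  assume G: "propG comb MC nC"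
  define u :: "(nat \<Rightarrow> real) \<Rightarrow> ereal" where "u x = (if x = comb_point k 0 then 1 else 0)" for x
  have "nC u \<le> \<alpha> + \<beta> k 0"
    by (rule comb_norm_least) (auto simp: u_def add_increasing2)
  also have "\<dots> < \<infinity>" using fin by (simp add: less_top)
  finally have "weakly_quasicont comb MC nC u" using G by (simp add: propG_def inN1_comb)
  then obtain E where E: "E \<subseteq> comb_points" "capC E < 1"
      "continuous_map (subtopology (mtopology_of comb) (comb_points - E)) euclideanreal (\<lambda>x. real_of_ereal (u x))"
    unfolding weakly_quasicont_def using zero_less_one by (metis ennreal_1 mspace_comb)
  have nE: "comb_point k n \<notin> E" for n
    using capC_ge_tooth[of k n E] \<beta>[of n] E(2) by (meson leD order_trans)
  \<comment> \<open>Continuity would make the limit point relatively open by itself, although none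
    of its neighbours has been removed.\<close>
  have "openin (subtopology (mtopology_of comb) (comb_points - E))
      {x \<in> topspace (subtopology (mtopology_of comb) (comb_points - E)). real_of_ereal (u x) \<in> {1/2<..}}"
    by (rule openin_continuous_map_preimage[OF E(3)]) auto
  moreover have "{x \<in> topspace (subtopology (mtopology_of comb) (comb_points - E)). real_of_ereal (u x) \<in> {1/2<..}}
      = {comb_point k 0}"
    using nE[of 0] by (auto simp: u_def)
  ultimately obtain W where W: "openin (mtopology_of comb) W" "{comb_point k 0} = W \<inter> (comb_points - E)"
    unfolding openin_subtopology by metis
  then obtain n where "0 < n" "comb_point k n \<in> W"
    using openin_comb_tail[of W k] by blast
  then have "comb_point k n \<in> {comb_point k 0}" using W(2) nE[of n] by auto
  then show False using \<open>0 < n\<close> by simp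
qed

text \<open>The limit point has capacity 0, while each of its neighbourhoods has capacity at least
  1.\<close>

lemma not_propE_if:
  assumes "\<alpha> = 0" "\<beta> k 0 = 0" and \<beta>: "\<And>n. n > 0 \<Longrightarrow> 1 \<le> \<beta> k n"
  shows "\<not> propE comb MC nC"
proof
  assume E: "propE comb MC nC"
  have "capC {comb_point k 0} \<le> 0"
    by (rule capC_least) (use assms in auto)
  then obtain G where G: "openin (mtopology_of comb) G" "{comb_point k 0} \<subseteq> G" "capC G < 1"
    using E[unfolded propE_def, rule_format, of "{comb_point k 0}" 1] by auto
  then obtain n where "0 < n" "comb_point k n \<in> G" using openin_comb_tail[of G k] by blast
  then show False using capC_ge_tooth[of k n G] \<beta>[of n] G(3) by (meson leD order_trans)
qed

text \<open>The hypothesis unites two cases: limit points are heavy either through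
  \<open>\<alpha> \<ge> 1\<close> or through \<open>\<beta> k 0 \<ge> 1\<close>.\<close>

lemma capC_nonempty_ge_1:
  assumes one: "\<And>k n. n > 0 \<or> \<alpha> < 1 \<Longrightarrow> 1 \<le> \<beta> k n" and E: "E \<subseteq> mspace comb" "E \<noteq> {}"
  shows "1 \<le> capC E"
proof -
  obtain x where "x \<in> E" "x \<in> comb_points" using E by auto
  then obtain k n where kn: "comb_point k n \<in> E" by (elim comb_pointsE) simp
  show ?thesis
  proof (cases "n > 0 \<or> \<alpha> < 1")
    case True
    then show ?thesis by (rule order_trans[OF one capC_ge_tooth[OF kn]])
  next
    case False
    then have "n = 0" "1 \<le> \<alpha>" by auto
    then show ?thesis using capC_ge_limit[of k E] kn by (auto intro: order_trans)
  qed
qed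

text \<open>The whole space is an open superset of capacity at most \<open>C\<close>, and nonempty
  sets have capacity at least 1; the empty set is its own open superset. With \<open>C = 1\<close>
  this gives (B).\<close>

lemma quasiouter_if:
  assumes C: "\<And>k n. \<alpha> + \<beta> k n \<le> ennreal C"
    and one: "\<And>k n. n > 0 \<or> \<alpha> < 1 \<Longrightarrow> 1 \<le> \<beta> k n"
  shows "quasiouter_c comb MC nC C"
  unfolding quasiouter_c_def
proof (intro allI impI)
  fix E assume E: "E \<subseteq> mspace comb"
  show "(INF G\<in>{G. openin (mtopology_of comb) G \<and> E \<subseteq> G}. capC G) \<le> ennreal C * capC E"
  proof (cases "E = {}")
    case True
    then have "(INF G\<in>{G. openin (mtopology_of comb) G \<and> E \<subseteq> G}. capC G) \<le> capC {}"
      by (intro INF_lower) auto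
    then show ?thesis by (simp add: cap_empty)
  next
    case False
    have "(INF G\<in>{G. openin (mtopology_of comb) G \<and> E \<subseteq> G}. capC G) \<le> capC comb_points"
      using E by (intro INF_lower) (auto simp: openin_comb_iff)
    also have "\<dots> \<le> ennreal C" by (rule capC_least) (use C in simp)
    also have "\<dots> \<le> ennreal C * capC E"
    proof -
      have "1 \<le> capC E" using one E False by (intro capC_nonempty_ge_1) auto
      then show ?thesis using mult_left_mono[of 1 "capC E" "ennreal C"] by simp
    qed
    finally show ?thesis .
  qed
qed

text \<open>The limit point has capacity at most 1, but each neighbourhood contains a point of
  weight at least \<open>C\<close> besides it and so has capacity at least
  \<open>1 + C\<close>.\<close>

lemma not_quasiouter_if:
  assumes "\<alpha> = 1" "\<beta> k 0 = 0" and \<beta>: "\<And>n. n > 0 \<Longrightarrow> ennreal C \<le> \<beta> k n" and "0 \<le> C"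
  shows "\<not> quasiouter_c comb MC nC C"
proof
  assume Q: "quasiouter_c comb MC nC C"
  have "1 + ennreal C \<le> (INF G\<in>{G. openin (mtopology_of comb) G \<and> {comb_point k 0} \<subseteq> G}. capC G)"
  proof (rule INF_greatest)
    fix G assume "G \<in> {G. openin (mtopology_of comb) G \<and> {comb_point k 0} \<subseteq> G}"
    then have G: "openin (mtopology_of comb) G" "comb_point k 0 \<in> G" by auto
    then obtain n where n: "0 < n" "comb_point k n \<in> G" using openin_comb_tail[of G k] by blast
    then have "1 + \<beta> k n \<le> capC G" using capC_ge_both[OF G(2) n(2)] assms(1) by simp
    then show "1 + ennreal C \<le> capC G" using \<beta>[OF n(1)] by (meson add_left_mono order_trans)
  qed
  also have "\<dots> \<le> ennreal C * capC {comb_point k 0}"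
    using Q[unfolded quasiouter_c_def, rule_format, of "{comb_point k 0}"] by simp
  also have "\<dots> \<le> ennreal C * 1"
    by (intro mult_left_mono capC_least) (use assms in auto)
  finally have "ennreal (1 + C) \<le> ennreal C" using \<open>0 \<le> C\<close> by (simp add: ennreal_plus)
  then show False using \<open>0 \<le> C\<close> by (simp add: ennreal_le_iff)
qed

text \<open>Nonempty sets have capacity at least 1, so an exceptional set of smaller capacity is
  empty and therefore open.\<close>

lemma propD_if:
  assumes one: "\<And>k n. n > 0 \<or> \<alpha> < 1 \<Longrightarrow> 1 \<le> \<beta> k n"
  shows "propD comb MC nC"
  unfolding propD_def quasicont_def
proof (intro allI impI)
  fix u and e :: real
  assume u: "weakly_quasicont comb MC nC u" and "0 < e"
  then have "0 < min e 1" by simp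
  then obtain E where E: "E \<subseteq> mspace comb" "capC E < ennreal (min e 1)"
      "\<forall>x\<in>mspace comb - E. \<bar>u x\<bar> \<noteq> \<infinity>"
      "continuous_map (subtopology (mtopology_of comb) (mspace comb - E)) euclideanreal (\<lambda>x. real_of_ereal (u x))"
    using u unfolding weakly_quasicont_def by blast
  have "ennreal (min e 1) \<le> 1" by (simp add: ennreal_le_1)
  then have "\<not> 1 \<le> capC E" using E(2) by order
  then have "E = {}" using one E(1) capC_nonempty_ge_1 by blast
  moreover have "capC {} < ennreal e" using \<open>0 < e\<close> by (simp add: cap_empty)
  ultimately show "\<exists>E. openin (mtopology_of comb) E \<and> capC E < ennreal e \<and>
      (\<forall>x\<in>mspace comb - E. \<bar>u x\<bar> \<noteq> \<infinity>) \<and>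
      continuous_map (subtopology (mtopology_of comb) (mspace comb - E)) euclideanreal (\<lambda>x. real_of_ereal (u x))"
    using E(3,4) by (intro exI[of _ "{}"]) auto
qed

section \<open>Continuity on the comb and limit points of zero capacity\<close>

lemma continuous_map_comb_iff:
  "continuous_map (mtopology_of comb) euclideanreal f \<longleftrightarrow>
    (\<forall>k. (\<lambda>n. f (comb_point k n)) \<longlonglongrightarrow> f (comb_point k 0))"
proof -
  have "continuous_map (mtopology_of comb) euclideanreal f \<longleftrightarrow>
      (\<forall>U. open U \<longrightarrow> openin (mtopology_of comb) {x \<in> comb_points. f x \<in> U})"
    by (simp add: continuous_map)
  also have "\<dots> \<longleftrightarrow> (\<forall>U k. open U \<longrightarrow> f (comb_point k 0) \<in> U \<longrightarrow> (\<exists>N. \<forall>n\<ge>N. f (comb_point k n) \<in> U))"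
    by (simp add: openin_comb_iff)
  also have "\<dots> \<longleftrightarrow> (\<forall>k. (\<lambda>n. f (comb_point k n)) \<longlonglongrightarrow> f (comb_point k 0))"
    by (simp add: tendsto_def eventually_sequentially) blast
  finally show ?thesis .
qed

definition "limit_points = {comb_point k 0 |k. True}"

lemma limit_points_subset: "limit_points \<subseteq> mspace comb"
  by (auto simp: limit_points_def)

text \<open>Without the limit points the space is discrete.\<close>

lemma continuous_map_off_limit_points:
  "continuous_map (subtopology (mtopology_of comb) (mspace comb - limit_points)) euclideanreal f"
  unfolding continuous_map
proof (intro conjI allI impI)
  fix U :: "real set"
  let ?V = "{x \<in> topspace (subtopology (mtopology_of comb) (mspace comb - limit_points)). f x \<in> U}"
  have "openin (mtopology_of comb) ?V" by (auto simp: openin_comb_iff limit_points_def)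
  then show "openin (subtopology (mtopology_of comb) (mspace comb - limit_points)) ?V"
    unfolding openin_subtopology by (intro exI[of _ ?V]) auto
qed auto

lemma capC_limit_points: "\<alpha> = 0 \<Longrightarrow> (\<And>k. \<beta> k 0 = 0) \<Longrightarrow> capC limit_points = 0"
proof -
  assume "\<alpha> = 0" "\<And>k. \<beta> k 0 = 0"
  then have "capC limit_points \<le> 0" by (intro capC_least) (auto simp: limit_points_def)
  then show ?thesis by simp
qed

lemma norm_finite_bound:
  assumes "nC u < \<infinity>" "\<And>k n. n > 0 \<Longrightarrow> ennreal (real n) \<le> \<beta> k n"
  obtains C where "0 \<le> C" "\<And>k n. n > 0 \<Longrightarrow> \<bar>u (comb_point k n)\<bar> \<le> ereal (C / real n)"
proof -
  obtain C where C: "nC u = ennreal C" "0 \<le> C" using assms(1) by (cases "nC u") auto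
  have "\<bar>u (comb_point k n)\<bar> \<le> ereal (C / real n)" if n: "n > 0" for k n
  proof -
    have "ennreal (real n) * abs_ennreal (u (comb_point k n)) \<le> \<beta> k n * abs_ennreal (u (comb_point k n))"
      using assms(2)[OF n] by (rule mult_right_mono) simp
    also have "\<dots> \<le> \<alpha> * abs_ennreal (u (comb_point k 0)) + \<beta> k n * abs_ennreal (u (comb_point k n))" by simp
    also have "\<dots> \<le> ennreal C" using comb_norm_upper C by metis
    finally have le: "ennreal (real n) * abs_ennreal (u (comb_point k n)) \<le> ennreal C" .
    show ?thesis
    proof (cases "u (comb_point k n)")
      case (real r)
      then have "real n * \<bar>r\<bar> \<le> C" using le C(2) by (simp flip: ennreal_mult)
      then show ?thesis using real n by (simp add: field_simps)
    qed (use le n in \<open>auto simp: abs_ennreal_def ennreal_mult_top top_unique\<close>)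
  qed
  then show thesis using that C(2) by blast
qed

text \<open>Weights growing like \<open>n\<close> force finite-norm functions to decay like
  \<open>C / n\<close> along each sequence. Resetting the limit points, a set of capacity 0, to 0
  makes the function continuous everywhere.\<close>

lemma propF_if:
  assumes "\<alpha> = 0" "\<And>k. \<beta> k 0 = 0" and \<beta>: "\<And>k n. n > 0 \<Longrightarrow> ennreal (real n) \<le> \<beta> k n"
  shows "propF comb MC nC"
  unfolding propF_def
proof (intro allI impI)
  fix u assume "inN1 comb MC nC u"
  then have "nC u < \<infinity>" by (simp add: inN1_comb)
  then obtain C where C: "0 \<le> C" "\<And>k n. n > 0 \<Longrightarrow> \<bar>u (comb_point k n)\<bar> \<le> ereal (C / real n)"
    using norm_finite_bound \<beta> by metis
  define v where "v x = (if x \<in> limit_points then 0 else u x)" for x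
  have v0: "v (comb_point k 0) = 0" for k by (auto simp: v_def limit_points_def)
  \<comment> \<open>For \<open>n = 0\<close> both sides are 0, since
    \<open>C / real 0 = 0\<close>.\<close>
  have vle: "\<bar>v (comb_point k n)\<bar> \<le> ereal (C / real n)" for k n
    using C(2)[of n k] v0[of k] C(1) by (cases "n = 0") (auto simp: v_def limit_points_def)
  have real_v: "\<bar>real_of_ereal (v (comb_point k n))\<bar> \<le> C / real n" for k n
    using vle[of k n] by (cases "v (comb_point k n)") auto
  have "(\<lambda>n. real_of_ereal (v (comb_point k n))) \<longlonglongrightarrow> 0" for k
    by (rule Lim_null_comparison[OF _ lim_const_over_n[of C]]) (use real_v in auto)
  then have "continuous_map (mtopology_of comb) euclideanreal (\<lambda>x. real_of_ereal (v x))"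
    by (simp add: continuous_map_comb_iff v0)
  moreover have "\<bar>v x\<bar> \<noteq> \<infinity>" if "x \<in> comb_points" for x
  proof -
    obtain k n where "x = comb_point k n" using \<open>x \<in> comb_points\<close> by (rule comb_pointsE)
    then show ?thesis using vle[of k n] by (cases "v x") auto
  qed
  ultimately have "quasicont comb MC nC v"
    unfolding quasicont_def
    by (intro allI impI exI[of _ "{}"])
      (auto simp: cap_empty subtopology_topspace[of "mtopology_of comb", simplified])
  moreover have "\<forall>x\<in>mspace comb - limit_points. v x = u x" by (simp add: v_def)
  ultimately show "\<exists>v. quasicont comb MC nC v \<and>
      (\<exists>E\<subseteq>mspace comb. capC E = 0 \<and> (\<forall>x\<in>mspace comb - E. v x = u x))"
    using capC_limit_points[OF assms(1,2)] limit_points_subset by blast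
qed

text \<open>One exceptional set of capacity 0, the limit points, serves every function and every
  \<epsilon>; at the remaining points positive mass forces finite values.\<close>

lemma propG_if:
  assumes "\<alpha> = 0" "\<And>k. \<beta> k 0 = 0" "\<And>k n. n > 0 \<Longrightarrow> 1 \<le> \<beta> k n"
  shows "propG comb MC nC"
  unfolding propG_def weakly_quasicont_def
proof (intro allI impI exI[of _ limit_points] conjI continuous_map_off_limit_points limit_points_subset)
  fix u and e :: real
  assume u: "inN1 comb MC nC u" and "0 < e"
  then show "capC limit_points < ennreal e" using capC_limit_points[OF assms(1,2)] by simp
  show "\<forall>x\<in>mspace comb - limit_points. \<bar>u x\<bar> \<noteq> \<infinity>"
  proof
    fix x assume "x \<in> mspace comb - limit_points"
    then obtain k n where x: "x = comb_point k n" "\<beta> k n \<noteq> 0"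
      using \<beta>_pos by (auto simp: comb_points_def limit_points_def)
    have "nC u < \<infinity>" using u by (simp only: inN1_comb)
    then have "AE x in MC. \<bar>u x\<bar> \<noteq> \<infinity>" by (rule AE_finite[OF measurable_MC])
    then have "(n = 0 \<and> \<alpha> \<noteq> 0 \<or> \<beta> k n \<noteq> 0) \<longrightarrow> \<bar>u (comb_point k n)\<bar> \<noteq> \<infinity>"
      unfolding AE_MC by (elim allE)
    then show "\<bar>u x\<bar> \<noteq> \<infinity>" unfolding x(1) using x(2) by (elim mp) (rule disjI2)
  qed
qed

text \<open>The test function alternates between 1 and 0 along each sequence. Null sets contain no
  isolated point and nonempty open sets have capacity at least 1, so a quasicontinuous
  representative would be continuous and still alternate.\<close>

lemma not_propF_if:
  assumes "\<alpha> = 0" "\<And>k. \<beta> k 0 = 0" "\<And>k n. n > 0 \<Longrightarrow> \<beta> k n = 1"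
  shows "\<not> propF comb MC nC"
proof
  assume F: "propF comb MC nC"
  define u :: "(nat \<Rightarrow> real) \<Rightarrow> ereal" where "u x = (if \<exists>j k. x = comb_point k (2 * j) then 1 else 0)" for x
  have u: "u (comb_point k n) = (if even n then 1 else 0)" for k n
    by (auto simp: u_def elim: evenE)
  have \<beta>1: "\<beta> k n \<le> 1" for k n using assms(2,3) by (cases n) auto
  have "nC u \<le> 1"
  proof (rule comb_norm_least)
    fix k n
    have "\<beta> k n * abs_ennreal (u (comb_point k n)) \<le> 1 * 1"
      by (intro mult_mono \<beta>1) (auto simp: u)
    then show "\<alpha> * abs_ennreal (u (comb_point k 0)) + \<beta> k n * abs_ennreal (u (comb_point k n)) \<le> 1"
      using assms(1) by simp
  qed
  then have "inN1 comb MC nC u" by (auto simp: inN1_comb intro: le_less_trans)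
  then obtain v E where v: "quasicont comb MC nC v" and E: "capC E = 0" "\<forall>x\<in>mspace comb - E. v x = u x"
    using F unfolding propF_def by blast
  obtain G where G: "openin (mtopology_of comb) G" "capC G < ennreal 1"
      "continuous_map (subtopology (mtopology_of comb) (mspace comb - G)) euclideanreal (\<lambda>x. real_of_ereal (v x))"
    using v[unfolded quasicont_def, rule_format, of 1] by auto
  have nG: "comb_point k n \<notin> G" for k n
  proof
    assume kn: "comb_point k n \<in> G"
    then obtain n where "0 < n" "comb_point k n \<in> G" using openin_comb_tail[OF G(1)] by (metis gr0I)
    then show False using capC_ge_tooth[of k n G] assms(3) G(2) by (auto simp: not_less[symmetric])
  qed
  then have "G = {}" using openin_subset[OF G(1)] by (auto simp: comb_points_def)
  then have "continuous_map (mtopology_of comb) euclideanreal (\<lambda>x. real_of_ereal (v x))"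
    using G(3) by (simp add: subtopology_topspace[of "mtopology_of comb", simplified])
  then have lim: "(\<lambda>n. real_of_ereal (v (comb_point 0 n))) \<longlonglongrightarrow> real_of_ereal (v (comb_point 0 0))"
    by (simp add: continuous_map_comb_iff)
  have "comb_point 0 n \<notin> E" if "n > 0" for n
    using capC_ge_tooth[of 0 n E] assms(3)[OF that, of 0] E(1) by auto
  then have vu: "v (comb_point 0 n) = (if even n then 1 else 0)" if "n > 0" for n
    using E(2) that u[of 0 n] by auto
  let ?f = "\<lambda>n. real_of_ereal (v (comb_point 0 n))"
  \<comment> \<open>The even indices start at 2 because \<open>v\<close> is not controlled at the
    limit point.\<close>
  have "(\<lambda>n. ?f (2 * n + 2)) \<longlonglongrightarrow> ?f 0" "(\<lambda>n. ?f (2 * n + 1)) \<longlonglongrightarrow> ?f 0"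
    by (rule LIMSEQ_subseq_LIMSEQ[OF lim, unfolded o_def]; simp add: strict_mono_def)+
  then have "(\<lambda>n::nat. 1) \<longlonglongrightarrow> ?f 0" "(\<lambda>n::nat. 0) \<longlonglongrightarrow> ?f 0" by (simp_all add: vu)
  then show False by (simp add: tendsto_const_iff)
qed

end

section \<open>Choice of the weights for each counterexample\<close>

theorem theorem1p2:
  shows "(\<forall>(m::'a metric) M nX c. QBFL m M nX c \<longrightarrow>
      (((propD m M nX \<and> propG m M nX) \<longleftrightarrow> (propE m M nX \<and> propF m M nX)) \<and>
       ((propE m M nX \<and> propF m M nX) \<longleftrightarrow> propA m M nX) \<and>
       (propA m M nX \<longrightarrow> propB m M nX) \<and> (propB m M nX \<longrightarrow> propC m M nX) \<and>
       (propC m M nX \<longrightarrow> propD m M nX) \<and> (propD m M nX \<longrightarrow> propE m M nX) \<and>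
       (propA m M nX \<longrightarrow> propF m M nX) \<and> (propF m M nX \<longrightarrow> propG m M nX))) \<and>
    (\<exists>(m::(nat \<Rightarrow> real) metric) M nX. QBFL m M nX 1 \<and> propB m M nX \<and> \<not> propA m M nX) \<and>
    (\<exists>(m::(nat \<Rightarrow> real) metric) M nX. QBFL m M nX 1 \<and> propC m M nX \<and> \<not> propB m M nX) \<and>
    (\<exists>(m::(nat \<Rightarrow> real) metric) M nX. QBFL m M nX 1 \<and> propD m M nX \<and> \<not> propC m M nX) \<and>
    (\<exists>(m::(nat \<Rightarrow> real) metric) M nX. QBFL m M nX 1 \<and> propB m M nX \<and> \<not> propG m M nX) \<and>
    (\<exists>(m::(nat \<Rightarrow> real) metric) M nX. QBFL m M nX 1 \<and> propG m M nX \<and> \<not> propF m M nX) \<and>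
    (\<exists>(m::(nat \<Rightarrow> real) metric) M nX. QBFL m M nX 1 \<and> propF m M nX \<and> \<not> propE m M nX) \<and>
    (\<exists>(m::(nat \<Rightarrow> real) metric) M nX c. QBFL m M nX c \<and>
       \<not> propA m M nX \<and> \<not> propB m M nX \<and> \<not> propC m M nX \<and> \<not> propD m M nX \<and>
       \<not> propE m M nX \<and> \<not> propF m M nX \<and> \<not> propG m M nX)"
proof -
  \<comment> \<open>The separate type \<open>'b\<close> allows use both for the given
    \<open>'a\<close> and for the comb.\<close>
  have implications: "((propD m M nX \<and> propG m M nX) \<longleftrightarrow> (propE m M nX \<and> propF m M nX)) \<and>
       ((propE m M nX \<and> propF m M nX) \<longleftrightarrow> propA m M nX) \<and>
       (propA m M nX \<longrightarrow> propB m M nX) \<and> (propB m M nX \<longrightarrow> propC m M nX) \<and>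
       (propC m M nX \<longrightarrow> propD m M nX) \<and> (propD m M nX \<longrightarrow> propE m M nX) \<and>
       (propA m M nX \<longrightarrow> propF m M nX) \<and> (propF m M nX \<longrightarrow> propG m M nX)"
    if "QBFL m M nX c" for m :: "'b metric" and M nX c
  proof -
    interpret qbfl m M nX c using that by (rule qbfl.intro)
    show ?thesis
      using A_imp_B B_imp_C C_imp_D D_imp_E A_imp_F F_imp_G E_F_imp_A D_G_imp_A by blast
  qed

  \<comment> \<open>With \<alpha> = 0 and all weights 1 every nonempty set has capacity 1.\<close>
  have B_not_G: "QBFL comb (comb_measure 0 (\<lambda>k n. 1)) (comb_norm 0 (\<lambda>k n. 1)) 1 \<and>
      propB comb (comb_measure 0 (\<lambda>k n. 1)) (comb_norm 0 (\<lambda>k n. 1)) \<and>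
      \<not> propG comb (comb_measure 0 (\<lambda>k n. 1)) (comb_norm 0 (\<lambda>k n. 1))"
  proof -
    interpret comb_lattice 0 "\<lambda>k n. 1" by standard simp
    show ?thesis
      unfolding propB_def
      by (intro conjI QBFL_comb quasiouter_if not_propG_if) simp_all
  qed
  let ?\<beta> = "\<lambda>k n. if n = 0 then 0 else 1 :: ennreal"
  \<comment> \<open>A limit point has capacity 1 and its neighbourhoods have capacity 2, so the
    constant 2 works and 1 fails.\<close>
  have C_not_B: "QBFL comb (comb_measure 1 ?\<beta>) (comb_norm 1 ?\<beta>) 1 \<and>
      propC comb (comb_measure 1 ?\<beta>) (comb_norm 1 ?\<beta>) \<and> \<not> propB comb (comb_measure 1 ?\<beta>) (comb_norm 1 ?\<beta>)"
  proof -
    interpret comb_lattice 1 ?\<beta> by standard simp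
    have "propC comb MC nC"
      unfolding propC_def by (intro exI[of _ 2] conjI quasiouter_if) simp_all
    moreover have "\<not> propB comb MC nC"
      unfolding propB_def by (rule not_quasiouter_if) simp_all
    ultimately show ?thesis using QBFL_comb by (intro conjI)
  qed
  \<comment> \<open>Weight \<open>k + 1\<close> on the \<open>k\<close>-th sequence defeats every
    single constant.\<close>
  let ?\<gamma> = "\<lambda>k n. if n = 0 then 0 else ennreal (real (Suc k))"
  have D_not_C: "QBFL comb (comb_measure 1 ?\<gamma>) (comb_norm 1 ?\<gamma>) 1 \<and>
      propD comb (comb_measure 1 ?\<gamma>) (comb_norm 1 ?\<gamma>) \<and> \<not> propC comb (comb_measure 1 ?\<gamma>) (comb_norm 1 ?\<gamma>)"
  proof -
    interpret comb_lattice 1 ?\<gamma> by standard simp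
    have "\<not> quasiouter_c comb MC nC C" if "1 \<le> C" for C
    proof -
      obtain k where "C \<le> real k" using real_arch_simple by blast
      then show ?thesis using that
        by (intro not_quasiouter_if[of k]) (simp_all add: ennreal_leI del: ennreal_plus)
    qed
    moreover have "propD comb MC nC" by (rule propD_if) auto
    ultimately show ?thesis unfolding propC_def using QBFL_comb by blast
  qed
  have G_not_F: "QBFL comb (comb_measure 0 ?\<beta>) (comb_norm 0 ?\<beta>) 1 \<and>
      propG comb (comb_measure 0 ?\<beta>) (comb_norm 0 ?\<beta>) \<and> \<not> propF comb (comb_measure 0 ?\<beta>) (comb_norm 0 ?\<beta>)"
  proof -
    interpret comb_lattice 0 ?\<beta> by standard simp
    show ?thesis by (intro conjI QBFL_comb propG_if not_propF_if) simp_all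
  qed
  \<comment> \<open>The weight \<open>n\<close> vanishes at the limit points and grows along the
    sequences.\<close>
  let ?\<delta> = "\<lambda>k n. ennreal (real n)"
  have F_not_E: "QBFL comb (comb_measure 0 ?\<delta>) (comb_norm 0 ?\<delta>) 1 \<and>
      propF comb (comb_measure 0 ?\<delta>) (comb_norm 0 ?\<delta>) \<and> \<not> propE comb (comb_measure 0 ?\<delta>) (comb_norm 0 ?\<delta>)"
  proof -
    interpret comb_lattice 0 ?\<delta> by standard simp
    show ?thesis by (intro conjI QBFL_comb propF_if not_propE_if) simp_all
  qed
  \<comment> \<open>Sequence 0 has a null limit point and refutes (E); sequence 1 has weight 1
    throughout and refutes (G). All other properties imply one of these two.\<close>
  let ?\<epsilon> = "\<lambda>k n. if k = 0 \<and> n = 0 then 0 else 1 :: ennreal"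
  have none: "QBFL comb (comb_measure 0 ?\<epsilon>) (comb_norm 0 ?\<epsilon>) 1 \<and>
      \<not> propE comb (comb_measure 0 ?\<epsilon>) (comb_norm 0 ?\<epsilon>) \<and> \<not> propG comb (comb_measure 0 ?\<epsilon>) (comb_norm 0 ?\<epsilon>)"
  proof -
    interpret comb_lattice 0 ?\<epsilon> by standard simp
    show ?thesis by (intro conjI QBFL_comb not_propE_if[of 0] not_propG_if[of 1]) simp_all
  qed

  show ?thesis
  proof (intro conjI)
    show "\<exists>(m::(nat \<Rightarrow> real) metric) M nX. QBFL m M nX 1 \<and> propB m M nX \<and> \<not> propA m M nX"
      using B_not_G implications by metis
    show "\<exists>(m::(nat \<Rightarrow> real) metric) M nX c. QBFL m M nX c \<and>
       \<not> propA m M nX \<and> \<not> propB m M nX \<and> \<not> propC m M nX \<and> \<not> propD m M nX \<and>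
       \<not> propE m M nX \<and> \<not> propF m M nX \<and> \<not> propG m M nX"
      using none implications by metis
  qed (use implications B_not_G C_not_B D_not_C G_not_F F_not_E in blast)+
qed

end
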